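(* Let $m$ be a positive even integer and $n$ a positive integer. The weighted count of perfect matchings of the honeycomb cylinder graph $H_{m,n}$ is $$\mathrm{M}(H_{m,n};x_1,\dots,x_m)=\begin{cases}\displaystyle\prod_{k=1}^{\lfloor n/2\rfloor}\Big[x_1\cdots x_m+\Big(2+2\cos\frac{2k\pi}{n+1}\Big)^{m/2}\Big], & n \text{ even},\\[2mm] \displaystyle x_1x_3\cdots x_{m-1}\prod_{k=1}^{\lfloor n/2\rfloor}\Big[x_1\cdots x_m+\Big(2+2\cos\frac{2k\pi}{n+1}\Big)^{m/2}\Big], & n\text{ odd}.\end{cases}$$
   Context: The honeycomb cylinder graph $H_{m,n}$ ($m$ even) consists of $m$ strands $S_1,\dots,S_m$, each a path on $n$ vertices with all edges of weight $1$, described as follows. If $n$ is even, put $s=n/2$: each strand has bottom vertices $u_1,\dots,u_s$ and top vertices $v_1,\dots,v_s$; for odd $i$ the edges of $S_i$ are $u_jv_j$ ($1\le j\le s$) and $u_jv_{j+1}$ ($1\le j\le s-1$); for even $i$ they are $u_jv_j$ ($1\le j\le s$) and $u_{j+1}v_j$ ($1\le j\le s-1$). If $n$ is odd, put $s=(n-1)/2$: for odd $i$, $S_i$ has bottom vertices $u_1,\dots,u_s$, top vertices $v_1,\dots,v_{s+1}$ and edges $u_jv_j,u_jv_{j+1}$ ($1\le j\le s$); for even $i$, $S_i$ has bottom vertices $u_1,\dots,u_{s+1}$, top vertices $v_1,\dots,v_s$ and edges $u_jv_j,u_{j+1}v_j$ ($1\le j\le s$). In both cases, for $i=1,\dots,m$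 (with $S_{m+1}:=S_1$), the $j$-th top vertex of $S_i$ is joined to the $j$-th bottom vertex of $S_{i+1}$ by an edge of weight $x_i$, for every $j$. $\mathrm{M}(H_{m,n};x_1,\dots,x_m)$ is the sum over perfect matchings of $H_{m,n}$ of the products of the weights of their edges. *)

theory Defs
  imports Complex_Main
begin

(* Finite undirected graphs are given by a vertex set and a set of two-element vertex sets. *)

definition perfect_matching :: "'v set \<Rightarrow> 'v set set \<Rightarrow> 'v set set \<Rightarrow> bool" where
  "perfect_matching V E M \<longleftrightarrow> M \<subseteq> E \<and> (\<forall>v\<in>V. \<exists>!e. e \<in> M \<and> v \<in> e)"

definition matching_sum :: "'v set \<Rightarrow> 'v set set \<Rightarrow> ('v set \<Rightarrow> real) \<Rightarrow> real" where
  "matching_sum V E w = (\<Sum>M\<in>{M. perfect_matching V E M}. \<Prod>e\<in>M. w e)"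

(* Bottom i j is the vertex u_j of the strand S_i, and Top i j is its vertex v_j. *)
datatype hvertex = Bottom nat nat | Top nat nat

definition bottom_count :: "nat \<Rightarrow> nat \<Rightarrow> nat" where
  "bottom_count n i =
    (if even n then n div 2
     else if odd i then (n - 1) div 2 else (n - 1) div 2 + 1)"

definition top_count :: "nat \<Rightarrow> nat \<Rightarrow> nat" where
  "top_count n i =
    (if even n then n div 2
     else if odd i then (n - 1) div 2 + 1 else (n - 1) div 2)"

definition strand_vertices :: "nat \<Rightarrow> nat \<Rightarrow> hvertex set" where
  "strand_vertices n i =
    {Bottom i j | j. j \<in> {1..bottom_count n i}} \<union> {Top i j | j. j \<in> {1..top_count n i}}"

definition strand_edges :: "nat \<Rightarrow> nat \<Rightarrow> hvertex set set" where
  "strand_edges n i =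
    (if even n then
       (let s = n div 2 in
        if odd i
        then {{Bottom i j, Top i j} | j. j \<in> {1..s}} \<union> {{Bottom i j, Top i (j + 1)} | j. j \<in> {1..s - 1}}
        else {{Bottom i j, Top i j} | j. j \<in> {1..s}} \<union> {{Bottom i (j + 1), Top i j} | j. j \<in> {1..s - 1}})
     else
       (let s = (n - 1) div 2 in
        if odd i
        then {{Bottom i j, Top i j} | j. j \<in> {1..s}} \<union> {{Bottom i j, Top i (j + 1)} | j. j \<in> {1..s}}
        else {{Bottom i j, Top i j} | j. j \<in> {1..s}} \<union> {{Bottom i (j + 1), Top i j} | j. j \<in> {1..s}}))"

definition next_strand :: "nat \<Rightarrow> nat \<Rightarrow> nat" where
  "next_strand m i = (if i = m then 1 else i + 1)"

definition link :: "nat \<Rightarrow> nat \<Rightarrow> nat \<Rightarrow> hvertex set" where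
  "link m i j = {Top i j, Bottom (next_strand m i) j}"

definition honeycomb_vertices :: "nat \<Rightarrow> nat \<Rightarrow> hvertex set" where
  "honeycomb_vertices m n = (\<Union>i\<in>{1..m}. strand_vertices n i)"

definition honeycomb_edges :: "nat \<Rightarrow> nat \<Rightarrow> hvertex set set" where
  "honeycomb_edges m n =
    (\<Union>i\<in>{1..m}. strand_edges n i) \<union> {link m i j | i j. i \<in> {1..m} \<and> j \<in> {1..top_count n i}}"

(* The index i of a linking edge is determined by its top vertex; see weight_link below. *)
definition honeycomb_weight :: "nat \<Rightarrow> nat \<Rightarrow> (nat \<Rightarrow> real) \<Rightarrow> hvertex set \<Rightarrow> real" where
  "honeycomb_weight m n x e =
    (if e \<in> (\<Union>i\<in>{1..m}. strand_edges n i) then 1 else x (THE i. \<exists>j. e = link m i j))"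

definition honeycomb_matching_sum :: "nat \<Rightarrow> nat \<Rightarrow> (nat \<Rightarrow> real) \<Rightarrow> real" where
  "honeycomb_matching_sum m n x =
    matching_sum (honeycomb_vertices m n) (honeycomb_edges m n) (honeycomb_weight m n x)"

lemma weight_strand_edge:
  assumes "i \<in> {1..m}" "e \<in> strand_edges n i"
  shows "honeycomb_weight m n x e = 1"
  using assms by (auto simp: honeycomb_weight_def)

lemma weight_link:
  assumes "even m" "i \<in> {1..m}"
  shows "honeycomb_weight m n x (link m i j) = x i"
proof -
  have "next_strand m i \<noteq> i"
    using assms by (auto simp: next_strand_def)
  then have "link m i j \<notin> strand_edges n k" for k
    by (auto simp: link_def strand_edges_def Let_def doubleton_eq_iff)
  moreover have "(THE k. \<exists>l. link m i j = link m k l) = i"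
    by (rule the_equality) (auto simp: link_def doubleton_eq_iff)
  ultimately show ?thesis
    by (simp add: honeycomb_weight_def)
qed

lemma honeycomb_edges_wf:
  assumes "even m" "e \<in> honeycomb_edges m n"
  shows "e \<subseteq> honeycomb_vertices m n \<and> card e = 2"
proof -
  have "e \<subseteq> honeycomb_vertices m n \<and> card e = 2"
    if i: "i \<in> {1..m}" and e: "e \<in> strand_edges n i" for i
  proof -
    have "e \<subseteq> strand_vertices n i \<and> card e = 2"
      using e
      by (auto simp: strand_edges_def strand_vertices_def bottom_count_def top_count_def Let_def
          split: if_splits)
    with i show ?thesis
      by (auto simp: honeycomb_vertices_def)
  qed
  moreover have "e \<subseteq> honeycomb_vertices m n \<and> card e = 2"
    if i: "i \<in> {1..m}" and j: "j \<in> {1..top_count n i}" and e: "e = link m i j" for i j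
  proof -
    have nx: "next_strand m i \<in> {1..m}"
      using i by (auto simp: next_strand_def)
    have "bottom_count n (next_strand m i) = top_count n i"
      using assms(1) by (auto simp: next_strand_def bottom_count_def top_count_def)
    then have "Top i j \<in> strand_vertices n i"
      "Bottom (next_strand m i) j \<in> strand_vertices n (next_strand m i)"
      using j by (auto simp: strand_vertices_def)
    with i nx show ?thesis
      unfolding e link_def honeycomb_vertices_def by auto
  qed
  ultimately show ?thesis
    using assms(2) unfolding honeycomb_edges_def by blast
qed

lemma finite_honeycomb_edges: "finite (honeycomb_edges m n)"
proof -
  have "{link m i j | i j. i \<in> {1..m} \<and> j \<in> {1..top_count n i}}
      = (\<Union>i\<in>{1..m}. link m i ` {1..top_count n i})"
    by blast
  moreover have "finite (strand_edges n i)" for i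
    by (auto simp: strand_edges_def Let_def)
  ultimately show ?thesis
    by (simp add: honeycomb_edges_def)
qed

end

theory Submission
  imports Defs "HOL-Combinatorics.Permutations" "HOL-Library.FuncSet" "HOL-Library.Infinite_Set"
begin

text \<open>Inside a strand, bottom vertices can only be matched to top vertices in increasing order, so
  the number of ways to match the bottom vertices \<open>U\<close> with the top vertices \<open>V\<close> is the minor with
  rows \<open>U\<close> and columns \<open>V\<close> of the 0/1 adjacency matrix \<open>B\<^sub>i\<close>. Linking edges force the set used in one
  strand to be the set used in the next one, and so the matching sum is the trace of a product of compound
  matrices. By Cauchy-Binet this is the trace of the compounds of \<open>(B\<^sub>1 B\<^sub>2)\<^bsup>m/2\<^esup>\<close>, which the
  sine matrix diagonalises: \<open>B\<^sub>2\<close> is the transpose of \<open>B\<^sub>1\<close>, and the path on \<open>n\<close> vertices has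
  eigenvalues \<open>2 cos (k pi / (n + 1))\<close>. The traces of the compounds are the elementary symmetric
  functions of the eigenvalues, and weighted with powers of \<open>x\<^sub>1 \<cdots> x\<^sub>m\<close> they add up to the product.\<close>

subsection \<open>Minors and the Cauchy-Binet formula\<close>

text \<open>The Leibniz formula for the determinant with entries \<open>P (f a) (g b)\<close>. Rows
  and columns are chosen by tuples, so they may repeat and come in any order.\<close>

definition tuple_minor :: "nat \<Rightarrow> ('a \<Rightarrow> 'b \<Rightarrow> real) \<Rightarrow> (nat \<Rightarrow> 'a) \<Rightarrow> (nat \<Rightarrow> 'b) \<Rightarrow> real" where
  "tuple_minor k P f g =
    (\<Sum>\<pi> | \<pi> permutes {..<k}. of_int (sign \<pi>) * (\<Prod>a<k. P (f a) (g (\<pi> a))))"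

text \<open>Matrices are total functions, so a product only has to name the range \<open>S\<close>
  of the summed index, and rectangular matrices need no dimensions.\<close>

definition mat_comp :: "'b set \<Rightarrow> ('a \<Rightarrow> 'b \<Rightarrow> real) \<Rightarrow> ('b \<Rightarrow> 'c \<Rightarrow> real) \<Rightarrow> 'a \<Rightarrow> 'c \<Rightarrow> real" where
  "mat_comp S P Q = (\<lambda>a c. \<Sum>b\<in>S. P a b * Q b c)"

lemma sign_compose_permutes:
  "\<pi> permutes {..<k::nat} \<Longrightarrow> \<rho> permutes {..<k} \<Longrightarrow> sign (\<pi> \<circ> \<rho>) = sign \<pi> * sign \<rho>"
  by (intro sign_compose permutes_imp_permutation[of "{..<k}"]) auto

lemma sign_sign_real: "real_of_int (sign \<pi>) * (real_of_int (sign \<pi>) * c) = c"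
  by (simp flip: mult.assoc of_int_mult)

text \<open>The Leibniz sum is reindexed by \<open>\<pi> \<mapsto> \<rho> \<circ> \<pi>\<close>,
  which multiplies every sign by that of \<open>\<rho>\<close>.\<close>

lemma tuple_minor_permute_right:
  assumes \<rho>: "\<rho> permutes {..<k}"
  shows "tuple_minor k P f (g \<circ> \<rho>) = of_int (sign \<rho>) * tuple_minor k P f g"
proof -
  have "tuple_minor k P f g
      = (\<Sum>\<pi> | \<pi> permutes {..<k}. of_int (sign (\<rho> \<circ> \<pi>)) * (\<Prod>a<k. P (f a) (g ((\<rho> \<circ> \<pi>) a))))"
    unfolding tuple_minor_def by (rule setum_permutations_compose_left[OF \<rho>])
  also have "\<dots> = of_int (sign \<rho>) * tuple_minor k P f (g \<circ> \<rho>)"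
    unfolding tuple_minor_def sum_distrib_left
    by (rule sum.cong) (auto simp: sign_compose_permutes[OF \<rho>] mult_ac)
  finally show ?thesis by (simp add: sign_sign_real)
qed

text \<open>After reindexing by \<open>\<pi> \<mapsto> \<pi> \<circ> \<rho>\<close>,
  \<open>\<rho>\<close> acts on rows and columns alike and only reorders the factors of each
  product.\<close>

lemma tuple_minor_permute_left:
  assumes \<rho>: "\<rho> permutes {..<k}"
  shows "tuple_minor k P (f \<circ> \<rho>) g = of_int (sign \<rho>) * tuple_minor k P f g"
proof -
  have "tuple_minor k P (f \<circ> \<rho>) g
      = (\<Sum>\<pi> | \<pi> permutes {..<k}. of_int (sign (\<pi> \<circ> \<rho>)) * (\<Prod>a<k. P (f (\<rho> a)) (g ((\<pi> \<circ> \<rho>) a))))"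
    unfolding tuple_minor_def o_def[of f] by (rule sum_permutations_compose_right[OF \<rho>])
  also have "\<dots> = (\<Sum>\<pi> | \<pi> permutes {..<k}. of_int (sign (\<pi> \<circ> \<rho>)) * (\<Prod>a<k. P (f a) (g (\<pi> a))))"
  proof (rule sum.cong)
    fix \<pi> :: "nat \<Rightarrow> nat"
    show "of_int (sign (\<pi> \<circ> \<rho>)) * (\<Prod>a<k. P (f (\<rho> a)) (g ((\<pi> \<circ> \<rho>) a)))
        = of_int (sign (\<pi> \<circ> \<rho>)) * (\<Prod>a<k. P (f a) (g (\<pi> a)))"
      using prod.permute[OF \<rho>, of "\<lambda>a. P (f a) (g (\<pi> a))"] by (simp add: o_def)
  qed simp
  also have "\<dots> = of_int (sign \<rho>) * tuple_minor k P f g"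
    unfolding tuple_minor_def sum_distrib_left
    by (rule sum.cong) (auto simp: sign_compose_permutes[OF _ \<rho>] mult_ac)
  finally show ?thesis .
qed

text \<open>Transposing the positions of two equal entries fixes \<open>g\<close> but changes the
  sign, so the minor is its own negative.\<close>

lemma tuple_minor_not_inj:
  assumes "\<not> inj_on g {..<k}"
  shows "tuple_minor k P f g = 0"
proof -
  obtain a b where ab: "a < k" "b < k" "a \<noteq> b" "g a = g b"
    using assms by (auto simp: inj_on_def)
  have "g \<circ> transpose a b = g"
    using ab(4) by (auto simp: transpose_def fun_eq_iff)
  then have "tuple_minor k P f g = - tuple_minor k P f g"
    using tuple_minor_permute_right[of "transpose a b" k P f g] ab
    by (simp add: permutes_swap_id sign_swap_id)
  then show ?thesis by simp
qed

text \<open>The sum runs over all tuples, so the substitution \<open>g \<mapsto> g \<circ> \<pi>\<close> absorbs one of the two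
  permutations; this is where the factor \<open>k!\<close> comes from.\<close>

lemma tuple_Cauchy_Binet:
  assumes S: "finite S"
  shows "(\<Sum>g\<in>{..<k} \<rightarrow>\<^sub>E S. tuple_minor k P f g * tuple_minor k Q g h)
    = fact k * tuple_minor k (mat_comp S P Q) f h"
proof -
  let ?T = "{..<k} \<rightarrow>\<^sub>E S"
  let ?\<Pi> = "{\<pi>. \<pi> permutes {..<k}}"
  have fT: "finite ?T" using S by (simp add: finite_PiE)
  have *: "(\<Sum>g\<in>?T. (\<Prod>a<k. P (f a) (g (\<pi> a))) * tuple_minor k Q g h)
      = of_int (sign \<pi>) * tuple_minor k (mat_comp S P Q) f h" if \<pi>: "\<pi> permutes {..<k}" for \<pi>
  proof -
    have "(\<Sum>g\<in>?T. (\<Prod>a<k. P (f a) (g (\<pi> a))) * tuple_minor k Q g h)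
        = (\<Sum>g\<in>?T. (\<Prod>a<k. P (f a) (g (\<pi> a))) * (of_int (sign \<pi>) * tuple_minor k Q (g \<circ> \<pi>) h))"
      by (simp add: tuple_minor_permute_left[OF \<pi>] sign_sign_real)
    also have "\<dots> = (\<Sum>g\<in>?T. (\<Prod>a<k. P (f a) (g a)) * (of_int (sign \<pi>) * tuple_minor k Q g h))"
    proof (rule sum.reindex_bij_witness[of _ "\<lambda>g. g \<circ> inv \<pi>" "\<lambda>g. g \<circ> \<pi>"])
      fix g assume g: "g \<in> ?T"
      show "g \<circ> \<pi> \<circ> inv \<pi> = g" using permutes_inv_o[OF \<pi>] by (simp add: comp_assoc)
      show "g \<circ> inv \<pi> \<circ> \<pi> = g" using permutes_inv_o[OF \<pi>] by (simp add: comp_assoc)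
      show "g \<circ> \<pi> \<in> ?T" using g permutes_in_image[OF \<pi>] permutes_not_in[OF \<pi>]
        by (auto simp: PiE_iff extensional_def)
      show "g \<circ> inv \<pi> \<in> ?T"
        using g permutes_in_image[OF permutes_inv[OF \<pi>]] permutes_not_in[OF permutes_inv[OF \<pi>]]
        by (auto simp: PiE_iff extensional_def)
    qed simp_all
    also have "\<dots> = of_int (sign \<pi>) * (\<Sum>\<rho>\<in>?\<Pi>. of_int (sign \<rho>) *
        (\<Sum>g\<in>?T. \<Prod>a<k. P (f a) (g a) * Q (g a) (h (\<rho> a))))"
      unfolding tuple_minor_def
      by (simp add: sum_distrib_left prod.distrib mult_ac) (rule sum.swap)
    \<comment> \<open>Summing over all tuples, not just injective ones, lets
      \<open>prod_sum_PiE\<close> turn the inner sum into a product of entries of the matrix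
      product.\<close>
    also have "\<dots> = of_int (sign \<pi>) * tuple_minor k (mat_comp S P Q) f h"
      unfolding tuple_minor_def mat_comp_def using S by (simp add: prod_sum_PiE)
    finally show ?thesis .
  qed
  have "(\<Sum>g\<in>?T. tuple_minor k P f g * tuple_minor k Q g h)
      = (\<Sum>\<pi>\<in>?\<Pi>. of_int (sign \<pi>) * (\<Sum>g\<in>?T. (\<Prod>a<k. P (f a) (g (\<pi> a))) * tuple_minor k Q g h))"
    unfolding tuple_minor_def[of k P] sum_distrib_right sum_distrib_left
    by (subst sum.swap) (simp add: mult_ac)
  also have "\<dots> = (\<Sum>\<pi>\<in>?\<Pi>. tuple_minor k (mat_comp S P Q) f h)"
    by (rule sum.cong) (auto simp: * sign_sign_real)
  also have "\<dots> = fact k * tuple_minor k (mat_comp S P Q) f h"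
    by (simp add: card_permutations[OF refl])
  finally show ?thesis .
qed

section \<open>From tuples to subsets\<close>

lemma enumerate_finite_props:
  fixes U :: "nat set"
  assumes "finite U"
  shows "bij_betw (enumerate U) {..<card U} U" "strict_mono_on {..<card U} (enumerate U)"
  using assms by (auto simp: finite_bij_enumerate finite_enumerate_mono_iff strict_mono_on_def
      intro: finite_enumerate_mono)

text \<open>A subset \<open>U\<close> of size \<open>k\<close> is the image of exactly
  \<open>k!\<close> injective tuples, all rearrangements of its increasing enumeration. Since
  \<open>enumerate U\<close> is not extensional, \<open>cong\<close> lets \<open>F\<close> see only
  the first \<open>k\<close> values.\<close>

lemma sum_tuples_eq_sum_subsets:
  fixes F :: "(nat \<Rightarrow> nat) \<Rightarrow> real"
  assumes S: "finite S"
    and perm: "\<And>f \<pi>. \<pi> permutes {..<k} \<Longrightarrow> F (f \<circ> \<pi>) = F f"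
    and cong: "\<And>f f'. (\<And>a. a < k \<Longrightarrow> f a = f' a) \<Longrightarrow> F f = F f'"
    and zero: "\<And>f. \<not> inj_on f {..<k} \<Longrightarrow> F f = 0"
  shows "(\<Sum>f\<in>{..<k} \<rightarrow>\<^sub>E S. F f) = fact k * (\<Sum>U | U \<subseteq> S \<and> card U = k. F (enumerate U))"
proof -
  let ?T = "{..<k} \<rightarrow>\<^sub>E S"
  let ?I = "{f \<in> ?T. inj_on f {..<k}}"
  let ?C = "{U. U \<subseteq> S \<and> card U = k}"
  have fT: "finite ?T" using S by (simp add: finite_PiE)
  have "(\<Sum>f\<in>?T. F f) = (\<Sum>f\<in>?I. F f)"
    using fT zero by (intro sum.mono_neutral_right) auto
  also have "\<dots> = (\<Sum>U\<in>?C. \<Sum>f | f \<in> ?I \<and> f ` {..<k} = U. F f)"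
  proof (rule sum.group[symmetric])
    show "(\<lambda>f. f ` {..<k}) ` ?I \<subseteq> ?C"
    proof
      fix U assume "U \<in> (\<lambda>f. f ` {..<k}) ` ?I"
      then obtain f where "U = f ` {..<k}" "f \<in> ?T" "inj_on f {..<k}" by blast
      then show "U \<in> ?C" using card_image[of f "{..<k}"] by auto
    qed
    show "finite ?I" by (rule finite_subset[OF _ fT]) blast
    show "finite ?C" by (rule finite_subset[of _ "Pow S"]) (use S in auto)
  qed
  also have "\<dots> = (\<Sum>U\<in>?C. fact k * F (enumerate U))"
  proof (rule sum.cong)
    fix U assume U: "U \<in> ?C"
    then have fU: "finite U" and [simp]: "card U = k" using S finite_subset by auto
    let ?e = "enumerate U"
    have e: "bij_betw ?e {..<k} U" using enumerate_finite_props(1)[OF fU] by simp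
    have "F f = F ?e" if f: "f \<in> ?I" "f ` {..<k} = U" for f
    proof -
      have bf: "bij_betw f {..<k} U" using f by (simp add: bij_betw_def)
      \<comment> \<open>The rank of \<open>f a\<close> in \<open>U\<close>, extended by the identity
        as \<open>permutes\<close> demands.\<close>
      define \<pi> where "\<pi> a = (if a < k then inv_into {..<k} ?e (f a) else a)" for a
      have "bij_betw (inv_into {..<k} ?e \<circ> f) {..<k} {..<k}"
        using bf bij_betw_inv_into[OF e] by (rule bij_betw_trans)
      then have "bij_betw \<pi> {..<k} {..<k}"
        by (rule bij_betw_cong[THEN iffD1, rotated]) (simp add: \<pi>_def)
      then have "\<pi> permutes {..<k}"
        by (rule bij_imp_permutes) (simp add: \<pi>_def)
      then have "F (?e \<circ> \<pi>) = F ?e" by (rule perm)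
      moreover have "F f = F (?e \<circ> \<pi>)"
        using bf e by (intro cong) (auto simp: \<pi>_def bij_betw_def f_inv_into_f)
      ultimately show ?thesis by simp
    qed
    then have "(\<Sum>f | f \<in> ?I \<and> f ` {..<k} = U. F f)
        = real (card {f \<in> {..<k} \<rightarrow>\<^sub>E U. f ` {..<k} = U \<and> inj_on f {..<k}}) * F ?e"
      using U by (subst sum_constant[symmetric]) (intro sum.cong, auto simp: PiE_iff)
    also have "card {f \<in> {..<k} \<rightarrow>\<^sub>E U. f ` {..<k} = U \<and> inj_on f {..<k}} = fact k"
    proof -
      have "{f \<in> {..<k} \<rightarrow>\<^sub>E U. f ` {..<k} = U \<and> inj_on f {..<k}}
          = {f \<in> {..<k} \<rightarrow>\<^sub>E U. inj_on f {..<k}}"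
      proof (intro Collect_cong conj_cong refl iffI conjI)
        fix f assume f: "f \<in> {..<k} \<rightarrow>\<^sub>E U" "inj_on f {..<k}"
        then show "f ` {..<k} = U" using fU by (intro card_subset_eq) (auto simp: card_image)
      qed auto
      then show ?thesis
        using card_inj_on_subset_funcset[of "{..<k}" U "{..<k}"] fU by (simp add: fact_prod_rev)
    qed
    finally show "(\<Sum>f | f \<in> ?I \<and> f ` {..<k} = U. F f) = fact k * F ?e" by simp
  qed simp
  finally show ?thesis by (simp add: sum_distrib_left)
qed

text \<open>An entry of a compound matrix. The value 0 for unequal sizes collects the compounds of
  all orders in one matrix indexed by sets, so sums may run over full power sets.\<close>

definition minor :: "(nat \<Rightarrow> nat \<Rightarrow> real) \<Rightarrow> nat set \<Rightarrow> nat set \<Rightarrow> real" where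
  "minor P U V =
    (if card U = card V then tuple_minor (card U) P (enumerate U) (enumerate V) else 0)"

lemma tuple_minor_cong:
  assumes "\<And>a b. a < k \<Longrightarrow> b < k \<Longrightarrow> P (f a) (g b) = Q (f' a) (g' b)"
  shows "tuple_minor k P f g = tuple_minor k Q f' g'"
  unfolding tuple_minor_def
proof (intro sum.cong arg_cong2[of _ _ _ _ "(*)"] prod.cong refl)
  fix \<pi> a assume "\<pi> \<in> {\<pi>. \<pi> permutes {..<k}}" "a \<in> {..<k}"
  then show "P (f a) (g (\<pi> a)) = Q (f' a) (g' (\<pi> a))"
    using permutes_in_image[of \<pi> "{..<k}" a] by (intro assms) auto
qed

text \<open>Permuting the middle tuple changes the sign of both factors, so their product is
  invariant and each subset is counted \<open>k!\<close> times, which cancels the factorial in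
  \<open>tuple_Cauchy_Binet\<close>.\<close>

lemma Cauchy_Binet:
  assumes S: "finite S"
  shows "(\<Sum>V\<in>Pow S. minor P U V * minor Q V W) = minor (mat_comp S P Q) U W"
proof (cases "card U = card W")
  case True
  define k where "k = card U"
  define F where "F g = tuple_minor k P (enumerate U) g * tuple_minor k Q g (enumerate W)" for g
  have "(\<Sum>V\<in>Pow S. minor P U V * minor Q V W) = (\<Sum>V | V \<subseteq> S \<and> card V = k. F (enumerate V))"
    using S True by (intro sum.mono_neutral_cong_right) (auto simp: F_def minor_def k_def)
  moreover have "(\<Sum>g\<in>{..<k} \<rightarrow>\<^sub>E S. F g)
      = fact k * (\<Sum>V | V \<subseteq> S \<and> card V = k. F (enumerate V))"
    using S
  proof (rule sum_tuples_eq_sum_subsets)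
    show "F (g \<circ> \<pi>) = F g" if "\<pi> permutes {..<k}" for g \<pi>
      using that
      by (simp add: F_def tuple_minor_permute_left tuple_minor_permute_right sign_sign_real mult_ac)
    show "F g = F g'" if "\<And>a. a < k \<Longrightarrow> g a = g' a" for g g'
      unfolding F_def using that by (intro arg_cong2[of _ _ _ _ "(*)"] tuple_minor_cong) auto
    show "F g = 0" if "\<not> inj_on g {..<k}" for g
      using that by (simp add: F_def tuple_minor_not_inj)
  qed
  ultimately show ?thesis
    using tuple_Cauchy_Binet[OF S, of k P "enumerate U" Q "enumerate W"] True
    by (simp add: F_def minor_def k_def)
next
  case False
  then show ?thesis by (auto simp: minor_def intro!: sum.neutral)
qed

lemma minor_cong:
  assumes "finite U" "finite V" "\<And>a b. a \<in> U \<Longrightarrow> b \<in> V \<Longrightarrow> P a b = Q a b"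
  shows "minor P U V = minor Q U V"
proof (cases "card U = card V")
  case True
  have "tuple_minor (card U) P (enumerate U) (enumerate V)
      = tuple_minor (card U) Q (enumerate U) (enumerate V)"
    using assms True by (intro tuple_minor_cong) (simp add: finite_enumerate_in_set)
  then show ?thesis by (simp only: minor_def)
qed (simp add: minor_def)

section \<open>Minors of matrices with monotone support\<close>

text \<open>An increasing map on an initial segment never lies below the identity; applied to
  \<open>\<pi>\<close> and to its inverse, this leaves equality.\<close>

lemma strict_mono_permutes_eq_id:
  assumes \<pi>: "\<pi> permutes {..<k::nat}" and mono: "strict_mono_on {..<k} \<pi>"
  shows "\<pi> = id"
proof -
  have le: "a \<le> \<rho> a" if "a < k" "strict_mono_on {..<k} \<rho>" for a and \<rho> :: "nat \<Rightarrow> nat"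
    using that
  proof (induction a)
    case (Suc a)
    then have "\<rho> a < \<rho> (Suc a)" by (intro strict_mono_onD[OF Suc.prems(2)]) auto
    then show ?case using Suc by auto
  qed simp
  have inv: "strict_mono_on {..<k} (inv \<pi>)"
  proof (rule strict_mono_onI)
    fix a b assume ab: "a \<in> {..<k}" "b \<in> {..<k}" "a < b"
    have "inv \<pi> a \<in> {..<k}" "inv \<pi> b \<in> {..<k}"
      using ab permutes_in_image[OF permutes_inv[OF \<pi>]] by auto
    then show "inv \<pi> a < inv \<pi> b"
      using ab(3) strict_mono_onD[OF mono, of "inv \<pi> b" "inv \<pi> a"] permutes_inverses(1)[OF \<pi>]
      by (metis not_less_iff_gr_or_eq)
  qed
  have "\<pi> a = a" for a
  proof (cases "a < k")
    case True
    then have "\<pi> a < k" using permutes_in_image[OF \<pi>] by auto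
    then have "\<pi> a \<le> a" using le[OF _ inv, of "\<pi> a"] permutes_inverses(2)[OF \<pi>] by simp
    with le[OF True mono] show ?thesis by simp
  next
    case False
    then show ?thesis using permutes_not_in[OF \<pi>] by auto
  qed
  then show ?thesis by auto
qed

text \<open>A permutation with a nonzero Leibniz term selects only nonzero entries, so
  \<open>mono\<close> makes it increasing; only the identity survives, with sign 1.\<close>

lemma minor_of_monotone_support:
  assumes fin: "finite U" "finite V"
    and mono: "\<And>u u' v v'. \<lbrakk>u \<in> U; u' \<in> U; v \<in> V; v' \<in> V; u < u'; P u v \<noteq> 0; P u' v' \<noteq> 0\<rbrakk> \<Longrightarrow> v \<le> v'"
  shows "minor P U V =
    (if card U = card V then \<Prod>a<card U. P (enumerate U a) (enumerate V a) else 0)"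
proof (cases "card U = card V")
  case True
  define k where "k = card U"
  have kV: "card V = k" using True k_def by simp
  let ?u = "enumerate U" and ?v = "enumerate V"
  have u: "strict_mono_on {..<k} ?u" "\<And>a. a < k \<Longrightarrow> ?u a \<in> U"
    using enumerate_finite_props[OF fin(1)] by (auto simp: k_def bij_betw_def)
  have v: "strict_mono_on {..<k} ?v" "\<And>a. a < k \<Longrightarrow> ?v a \<in> V"
    using enumerate_finite_props[OF fin(2)] by (auto simp: kV bij_betw_def)
  have "tuple_minor k P ?u ?v = (\<Sum>\<pi>\<in>{id}. of_int (sign \<pi>) * (\<Prod>a<k. P (?u a) (?v (\<pi> a))))"
    unfolding tuple_minor_def
  proof (rule sum.mono_neutral_right)
    show "\<forall>\<pi>\<in>{\<pi>. \<pi> permutes {..<k}} - {id}. of_int (sign \<pi>) * (\<Prod>a<k. P (?u a) (?v (\<pi> a))) = 0"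
    proof
      fix \<pi> assume "\<pi> \<in> {\<pi>. \<pi> permutes {..<k}} - {id}"
      then have \<pi>: "\<pi> permutes {..<k}" "\<pi> \<noteq> id" by auto
      then have \<pi>k: "\<pi> a < k" if "a < k" for a using permutes_in_image[OF \<pi>(1)] that by auto
      have "\<exists>a<k. P (?u a) (?v (\<pi> a)) = 0"
      proof (rule ccontr)
        assume nz: "\<not> ?thesis"
        have "strict_mono_on {..<k} \<pi>"
        proof (rule strict_mono_onI)
          fix a b assume ab: "a \<in> {..<k}" "b \<in> {..<k}" "a < b"
          then have "?v (\<pi> a) \<le> ?v (\<pi> b)"
            using nz u v \<pi>k by (intro mono[of "?u a" "?u b"]) (auto intro: strict_mono_onD)
          then have "\<not> \<pi> b < \<pi> a"
            using strict_mono_onD[OF v(1), of "\<pi> b" "\<pi> a"] \<pi>k ab by auto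
          \<comment> \<open>\<open>mono\<close> yields a weak inequality; injectivity makes it
            strict.\<close>
          moreover have "\<pi> a \<noteq> \<pi> b" using permutes_inj[OF \<pi>(1)] ab by (auto simp: inj_eq)
          ultimately show "\<pi> a < \<pi> b" by simp
        qed
        with \<pi> strict_mono_permutes_eq_id show False by blast
      qed
      then show "of_int (sign \<pi>) * (\<Prod>a<k. P (?u a) (?v (\<pi> a))) = 0" by auto
    qed
  qed (auto simp: finite_permutations permutes_id)
  then show ?thesis using True by (simp add: minor_def k_def)
qed (simp add: minor_def)

text \<open>Diagonal support is monotone, so the minor is a product of entries at equal ranks, and
  two different sets of the same size disagree at some rank.\<close>

lemma minor_diagonal:
  assumes fin: "finite U" "finite V"
  shows "minor (\<lambda>a b. if a = b then d a else 0) U V = (if U = V then prod d U else 0)"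
proof -
  have eq: "minor (\<lambda>a b. if a = b then d a else 0) U V = (if card U = card V
      then \<Prod>a<card U. if enumerate U a = enumerate V a then d (enumerate U a) else 0 else 0)"
    by (rule minor_of_monotone_support) (use fin in \<open>auto split: if_splits\<close>)
  show ?thesis
  proof (cases "U = V")
    case True
    then show ?thesis
      using prod.reindex_bij_betw[OF enumerate_finite_props(1)[OF fin(1)], of d] unfolding eq by simp
  next
    case False
    have "\<exists>a<card U. enumerate U a \<noteq> enumerate V a" if "card U = card V"
    proof (rule ccontr)
      assume "\<not> ?thesis"
      then have "enumerate U ` {..<card U} = enumerate V ` {..<card V}"
        using that by auto
      then show False
        using False enumerate_finite_props(1)[OF fin(1)] enumerate_finite_props(1)[OF fin(2)]
        by (auto simp: bij_betw_def)
    qed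
    then show ?thesis using False by (auto simp: eq)
  qed
qed

section \<open>Weighted traces of compound matrices\<close>

text \<open>With \<open>D\<close> the diagonal matrix of \<open>\<mu>\<close>, the compound of
  \<open>Q D R\<close> is the product of the compounds, and under the trace the outer two combine to
  the compound of \<open>R Q\<close>, the identity. What remains is the expansion of the product
  over \<open>S\<close> into subsets.\<close>

lemma weighted_minor_trace_conjugation:
  fixes S :: "nat set" and X :: real
  assumes S: "finite S"
    and inv: "\<And>k l. k \<in> S \<Longrightarrow> l \<in> S \<Longrightarrow> mat_comp S R Q k l = (if k = l then 1 else 0)"
    and P: "\<And>a b. a \<in> S \<Longrightarrow> b \<in> S \<Longrightarrow> P a b = (\<Sum>k\<in>S. Q a k * \<mu> k * R k b)"
  shows "(\<Sum>U\<in>Pow S. X ^ (card S - card U) * minor P U U) = (\<Prod>k\<in>S. X + \<mu> k)"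
proof -
  let ?D = "\<lambda>a b. if a = b then \<mu> a else 0"
  let ?w = "\<lambda>U. X ^ (card S - card U)"
  have fin: "finite U" if "U \<in> Pow S" for U using that S finite_subset by auto
  have "minor P U U = (\<Sum>V\<in>Pow S. prod \<mu> V * (minor R V U * minor Q U V))" if U: "U \<in> Pow S" for U
  proof -
    have PQ: "P a b = mat_comp S (mat_comp S Q ?D) R a b" if "a \<in> S" "b \<in> S" for a b
    proof -
      have "mat_comp S Q ?D a k = Q a k * \<mu> k" if "k \<in> S" for k
        unfolding mat_comp_def using S that by (subst sum.remove[of _ k]) (auto intro!: sum.neutral)
      then show ?thesis using P[OF that] by (simp add: mat_comp_def[of S "mat_comp S Q ?D"])
    qed
    have "minor P U U = minor (mat_comp S (mat_comp S Q ?D) R) U U"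
      using U by (intro minor_cong fin PQ) auto
    also have "\<dots> = (\<Sum>V\<in>Pow S. \<Sum>W\<in>Pow S. minor Q U W * minor ?D W V * minor R V U)"
      by (simp add: Cauchy_Binet[OF S, symmetric] sum_distrib_right)
    also have "\<dots> = (\<Sum>V\<in>Pow S. \<Sum>W\<in>Pow S. if W = V then minor Q U V * prod \<mu> V * minor R V U else 0)"
      by (intro sum.cong refl) (auto simp: minor_diagonal[OF fin fin])
    also have "\<dots> = (\<Sum>V\<in>Pow S. prod \<mu> V * (minor R V U * minor Q U V))"
      using S by (simp add: mult_ac)
    finally show ?thesis .
  qed
  then have "(\<Sum>U\<in>Pow S. ?w U * minor P U U)
      = (\<Sum>U\<in>Pow S. \<Sum>V\<in>Pow S. ?w U * (prod \<mu> V * (minor R V U * minor Q U V)))"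
    by (simp add: sum_distrib_left)
  \<comment> \<open>Minors between sets of unequal size vanish, so the weight may be read off
    \<open>V\<close>; this frees the sum over \<open>U\<close> for Cauchy-Binet.\<close>
  also have "\<dots> = (\<Sum>U\<in>Pow S. \<Sum>V\<in>Pow S. ?w V * (prod \<mu> V * (minor R V U * minor Q U V)))"
    by (intro sum.cong refl) (auto simp: minor_def)
  also have "\<dots> = (\<Sum>V\<in>Pow S. ?w V * (prod \<mu> V * minor (mat_comp S R Q) V V))"
    by (subst sum.swap) (simp add: sum_distrib_left Cauchy_Binet[OF S, symmetric])
  also have "\<dots> = (\<Sum>V\<in>Pow S. prod \<mu> V * X ^ (card S - card V))"
  proof (intro sum.cong refl)
    fix V assume V: "V \<in> Pow S"
    have "minor (mat_comp S R Q) V V = minor (\<lambda>a b. if a = b then 1 else 0) V V"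
      using V by (intro minor_cong fin inv) auto
    then show "?w V * (prod \<mu> V * minor (mat_comp S R Q) V V) = prod \<mu> V * ?w V"
      using fin[OF V] by (simp add: minor_diagonal)
  qed
  also have "\<dots> = (\<Sum>V\<in>Pow S. prod \<mu> V * (\<Prod>k\<in>S - V. X))"
    using fin S by (intro sum.cong refl) (auto simp: card_Diff_subset)
  also have "\<dots> = (\<Prod>k\<in>S. \<mu> k + X)"
    using prod_add[OF S, of \<mu> "\<lambda>_. X"] by simp
  finally show ?thesis by (simp add: add.commute)
qed

section \<open>Sums over paths and cycles of index sets\<close>

text \<open>The product of \<open>B 1\<close> to \<open>B j\<close>, where \<open>B i\<close> has
  rows in \<open>I i\<close> and columns in \<open>I (Suc i)\<close>.\<close>

primrec path_mat :: "(nat \<Rightarrow> nat set) \<Rightarrow> (nat \<Rightarrow> nat \<Rightarrow> nat \<Rightarrow> real) \<Rightarrow> nat \<Rightarrow> nat \<Rightarrow> nat \<Rightarrow> real" where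
  "path_mat I B 0 = (\<lambda>a b. if a = b then 1 else 0)"
| "path_mat I B (Suc j) = mat_comp (I (Suc j)) (path_mat I B j) (B (Suc j))"

text \<open>The last set is split off and Cauchy-Binet sums out the set before it. \<open>G\<close>
  couples the two ends; it stays arbitrary in the induction so that it can absorb the last
  minor.\<close>

lemma sum_minor_paths:
  assumes fin: "\<And>i. finite (I i)"
  shows "(\<Sum>U\<in>PiE {1..Suc j} (\<lambda>i. Pow (I i)).
      (\<Prod>i = 1..j. minor (B i) (U i) (U (Suc i))) * G (U 1) (U (Suc j)))
    = (\<Sum>a\<in>Pow (I 1). \<Sum>b\<in>Pow (I (Suc j)). minor (path_mat I B j) a b * G a b)"
proof (induction j arbitrary: G)
  case 0
  have "(\<Sum>U\<in>PiE {1..Suc 0} (\<lambda>i. Pow (I i)). G (U 1) (U (Suc 0))) = (\<Sum>a\<in>Pow (I 1). G a a)"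
  proof (rule sum.reindex_bij_witness[of _ "\<lambda>a. \<lambda>i\<in>{1}. a" "\<lambda>U. U 1"])
    fix U assume "U \<in> PiE {1..Suc 0} (\<lambda>i. Pow (I i))"
    then show "(\<lambda>i\<in>{1}. U 1) = U"
      by (intro extensionalityI[of _ "{1}"]) (auto simp: PiE_iff)
  qed (auto simp: PiE_iff)
  also have "\<dots> = (\<Sum>a\<in>Pow (I 1). \<Sum>b\<in>Pow (I 1). if a = b then G a b else 0)"
    using fin by simp
  also have "\<dots> = (\<Sum>a\<in>Pow (I 1). \<Sum>b\<in>Pow (I 1). minor (path_mat I B 0) a b * G a b)"
  proof (intro sum.cong refl)
    fix a b assume "a \<in> Pow (I 1)" "b \<in> Pow (I 1)"
    then have "finite a" "finite b" using fin finite_subset by blast+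
    then show "(if a = b then G a b else 0) = minor (path_mat I B 0) a b * G a b"
      by (simp add: minor_diagonal)
  qed
  finally show ?case by simp
next
  case (Suc j)
  let ?J = "{1..Suc j}" and ?A = "\<lambda>i. Pow (I i)" and ?s = "Suc (Suc j)"
  let ?f = "\<lambda>U. (\<Prod>i = 1..Suc j. minor (B i) (U i) (U (Suc i))) * G (U 1) (U ?s)"
  have "PiE {1..?s} ?A = (\<lambda>(y, g). g(?s := y)) ` (?A ?s \<times> PiE ?J ?A)"
    using PiE_insert_eq[of ?s ?J ?A] by (simp add: atLeastAtMostSuc_conv)
  moreover have "inj_on (\<lambda>(y, g). g(?s := y)) (?A ?s \<times> PiE ?J ?A)"
    by (rule inj_combinator) simp
  ultimately have "(\<Sum>U\<in>PiE {1..?s} ?A. ?f U) = (\<Sum>(c, g)\<in>?A ?s \<times> PiE ?J ?A. ?f (g(?s := c)))"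
    by (simp add: sum.reindex case_prod_unfold o_def)
  also have "\<dots> = (\<Sum>g\<in>PiE ?J ?A. \<Sum>c\<in>?A ?s. ?f (g(?s := c)))"
    by (subst sum.swap) (rule sum.cartesian_product[symmetric])
  also have "\<dots> = (\<Sum>g\<in>PiE ?J ?A. (\<Prod>i = 1..j. minor (B i) (g i) (g (Suc i))) *
      (\<Sum>c\<in>?A ?s. minor (B (Suc j)) (g (Suc j)) c * G (g 1) c))"
  proof (rule sum.cong[OF refl])
    fix g
    have "(\<Prod>i = 1..j. minor (B i) ((g(?s := c)) i) ((g(?s := c)) (Suc i)))
        = (\<Prod>i = 1..j. minor (B i) (g i) (g (Suc i)))" for c
      by (rule prod.cong) auto
    then show "(\<Sum>c\<in>?A ?s. ?f (g(?s := c))) = (\<Prod>i = 1..j. minor (B i) (g i) (g (Suc i))) *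
      (\<Sum>c\<in>?A ?s. minor (B (Suc j)) (g (Suc j)) c * G (g 1) c)"
      by (simp add: sum_distrib_left mult_ac)
  qed
  also have "\<dots> = (\<Sum>a\<in>Pow (I 1). \<Sum>b\<in>?A (Suc j). minor (path_mat I B j) a b *
      (\<Sum>c\<in>?A ?s. minor (B (Suc j)) b c * G a c))"
    by (rule Suc.IH)
  also have "\<dots> = (\<Sum>a\<in>Pow (I 1). \<Sum>c\<in>?A ?s.
      (\<Sum>b\<in>?A (Suc j). minor (path_mat I B j) a b * minor (B (Suc j)) b c) * G a c)"
    by (simp only: sum_distrib_left sum_distrib_right mult.assoc)
      (intro sum.cong refl sum.swap)
  also have "\<dots> = (\<Sum>a\<in>Pow (I 1). \<Sum>c\<in>?A ?s. minor (path_mat I B (Suc j)) a c * G a c)"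
    by (simp add: Cauchy_Binet[OF fin])
  finally show ?case .
qed

text \<open>The cycle is cut at the first strand: the minor leading back to \<open>U 1\<close>
  becomes part of the coupling \<open>G\<close>, and one more use of Cauchy-Binet gives a weighted
  trace.\<close>

lemma sum_minor_cycles:
  assumes fin: "\<And>i. finite (I i)" and m: "m > 0"
  shows "(\<Sum>U\<in>PiE {1..m} (\<lambda>i. Pow (I i)). w (U 1) * (\<Prod>i = 1..m. minor (B i) (U i) (U (next_strand m i))))
    = (\<Sum>a\<in>Pow (I 1). w a * minor (path_mat I B m) a a)"
proof -
  obtain j where j: "m = Suc j" using m by (cases m) auto
  have prod: "(\<Prod>i = 1..m. minor (B i) (U i) (U (next_strand m i)))
      = (\<Prod>i = 1..j. minor (B i) (U i) (U (Suc i))) * minor (B m) (U m) (U 1)" for U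
  proof -
    have "(\<Prod>i = 1..j. minor (B i) (U i) (U (next_strand m i)))
        = (\<Prod>i = 1..j. minor (B i) (U i) (U (Suc i)))"
      by (rule prod.cong) (auto simp: next_strand_def j)
    then show ?thesis by (simp add: j next_strand_def)
  qed
  have "(\<Sum>U\<in>PiE {1..m} (\<lambda>i. Pow (I i)). w (U 1) * (\<Prod>i = 1..m. minor (B i) (U i) (U (next_strand m i))))
      = (\<Sum>a\<in>Pow (I 1). \<Sum>b\<in>Pow (I m). minor (path_mat I B j) a b * (w a * minor (B m) b a))"
    unfolding prod using sum_minor_paths[OF fin, where j = j and B = B and G = "\<lambda>a b. w a * minor (B m) b a"]
    by (simp add: j mult_ac)
  also have "\<dots> = (\<Sum>a\<in>Pow (I 1). w a * (\<Sum>b\<in>Pow (I m). minor (path_mat I B j) a b * minor (B m) b a))"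
    by (simp add: sum_distrib_left mult_ac)
  also have "\<dots> = (\<Sum>a\<in>Pow (I 1). w a * minor (path_mat I B m) a a)"
    by (simp add: Cauchy_Binet[OF fin] j)
  finally show ?thesis .
qed

section \<open>Counting matchings inside a monotone relation\<close>

text \<open>Monotonicity leaves at most one bijection inside \<open>A\<close>, the increasing one.
  Both sides are 1 if the sizes agree and all pairs of equal rank lie in \<open>A\<close>, and 0
  otherwise.\<close>

lemma card_monotone_matchings:
  fixes A :: "(nat \<times> nat) set"
  assumes fin: "finite U" "finite V"
    and mono: "\<And>u u' v v'. \<lbrakk>(u, v) \<in> A; (u', v') \<in> A; u < u'\<rbrakk> \<Longrightarrow> v \<le> v'"
  shows "real (card {R. R \<subseteq> A \<and> single_valued R \<and> single_valued (R\<inverse>) \<and> Domain R = U \<and> Range R = V})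
    = minor (\<lambda>a b. of_bool ((a, b) \<in> A)) U V" (is "real (card ?M) = _")
proof -
  let ?u = "enumerate U" and ?v = "enumerate V"
  have eq: "minor (\<lambda>a b. of_bool ((a, b) \<in> A)) U V
      = (if card U = card V then \<Prod>a<card U. of_bool ((?u a, ?v a) \<in> A) else 0)"
    by (rule minor_of_monotone_support) (use fin mono in \<open>auto split: if_splits\<close>)
  have graph: "\<exists>\<sigma>. bij_betw \<sigma> U V \<and> R = (\<lambda>u. (u, \<sigma> u)) ` U" if R: "R \<in> ?M" for R
  proof -
    define \<sigma> where "\<sigma> u = (THE v. (u, v) \<in> R)" for u
    have \<sigma>: "\<sigma> u = v" if "(u, v) \<in> R" for u v
      unfolding \<sigma>_def using R that by (intro the_equality) (auto dest: single_valuedD)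
    have "R = (\<lambda>u. (u, \<sigma> u)) ` U"
    proof (intro equalityI subsetI)
      fix p assume "p \<in> R"
      then show "p \<in> (\<lambda>u. (u, \<sigma> u)) ` U" using R \<sigma>[of "fst p" "snd p"] by (cases p) auto
    next
      fix p assume "p \<in> (\<lambda>u. (u, \<sigma> u)) ` U"
      then obtain u v where "p = (u, \<sigma> u)" "(u, v) \<in> R" using R by auto
      then show "p \<in> R" using \<sigma> by simp
    qed
    moreover have "bij_betw \<sigma> U V"
    proof (rule bij_betw_imageI)
      show "inj_on \<sigma> U"
      proof (rule inj_onI)
        fix u u' assume "u \<in> U" "u' \<in> U" "\<sigma> u = \<sigma> u'"
        then have "(u, \<sigma> u) \<in> R" "(u', \<sigma> u) \<in> R" using calculation by auto
        moreover have "single_valued (R\<inverse>)" using R by simp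
        ultimately show "u = u'" by (meson converseI single_valuedD)
      qed
      have "V = Range ((\<lambda>u. (u, \<sigma> u)) ` U)" using R calculation by simp
      then show "\<sigma> ` U = V" by (simp add: Range_snd image_image)
    qed
    ultimately show ?thesis by blast
  qed
  show ?thesis
  proof (cases "card U = card V")
    case False
    have "?M = {}"
    proof (rule equals0I)
      fix R assume "R \<in> ?M"
      from graph[OF this] obtain \<sigma> where "bij_betw \<sigma> U V" by blast
      then show False using False bij_betw_same_card by blast
    qed
    then show ?thesis using False by (simp only: eq card.empty if_False of_nat_0)
  next
    case True
    define k where "k = card U"
    have u: "bij_betw ?u {..<k} U" "strict_mono_on {..<k} ?u"
      using enumerate_finite_props[OF fin(1)] by (auto simp: k_def)
    have v: "bij_betw ?v {..<k} V" "strict_mono_on {..<k} ?v"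
      using enumerate_finite_props[OF fin(2)] by (auto simp: k_def True)
    \<comment> \<open>The only candidate: it pairs elements of equal rank.\<close>
    define R0 where "R0 = (\<lambda>a. (?u a, ?v a)) ` {..<k}"
    have unique: "R = R0" if R: "R \<in> ?M" for R
    proof -
      obtain \<sigma> where \<sigma>: "bij_betw \<sigma> U V" "R = (\<lambda>u. (u, \<sigma> u)) ` U" using graph[OF R] by blast
      \<comment> \<open>This is \<open>\<sigma>\<close> expressed in ranks; being an increasing
        permutation, it is the identity.\<close>
      define \<pi> where "\<pi> a = (if a < k then inv_into {..<k} ?v (\<sigma> (?u a)) else a)" for a
      have "bij_betw (inv_into {..<k} ?v \<circ> (\<sigma> \<circ> ?u)) {..<k} {..<k}"
        using bij_betw_trans[OF bij_betw_trans[OF u(1) \<sigma>(1)] bij_betw_inv_into[OF v(1)]] .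
      then have "bij_betw \<pi> {..<k} {..<k}"
        by (rule bij_betw_cong[THEN iffD1, rotated]) (simp add: \<pi>_def)
      then have \<pi>: "\<pi> permutes {..<k}"
        by (rule bij_imp_permutes) (simp add: \<pi>_def)
      have uU: "?u a \<in> U" if "a < k" for a using u(1) that by (auto simp: bij_betw_def)
      have v\<pi>: "?v (\<pi> a) = \<sigma> (?u a)" if "a < k" for a
      proof -
        have "\<sigma> (?u a) \<in> ?v ` {..<k}" using uU[OF that] \<sigma>(1) v(1) by (auto simp: bij_betw_def)
        then show ?thesis using that by (simp add: \<pi>_def f_inv_into_f)
      qed
      have "strict_mono_on {..<k} \<pi>"
      proof (rule strict_mono_onI)
        fix a b assume ab: "a \<in> {..<k}" "b \<in> {..<k}" "a < b"
        have "(?u a, \<sigma> (?u a)) \<in> A" "(?u b, \<sigma> (?u b)) \<in> A"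
          using R \<sigma>(2) uU ab by auto
        then have "?v (\<pi> a) \<le> ?v (\<pi> b)"
          using mono strict_mono_onD[OF u(2) ab] v\<pi> ab by auto
        then have "\<not> \<pi> b < \<pi> a"
          using strict_mono_onD[OF v(2), of "\<pi> b" "\<pi> a"] permutes_in_image[OF \<pi>] ab by auto
        moreover have "\<pi> a \<noteq> \<pi> b" using permutes_inj[OF \<pi>] ab by (auto simp: inj_eq)
        ultimately show "\<pi> a < \<pi> b" by simp
      qed
      then have "\<pi> = id" using strict_mono_permutes_eq_id[OF \<pi>] by simp
      then have "\<sigma> (?u a) = ?v a" if "a < k" for a using v\<pi>[OF that] by simp
      then have "(\<lambda>u. (u, \<sigma> u)) ` ?u ` {..<k} = R0"
        unfolding R0_def image_image by (intro image_cong) auto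
      then show ?thesis using \<sigma>(2) u(1) by (simp add: bij_betw_def)
    qed
    have "R0 \<in> ?M \<longleftrightarrow> (\<forall>a<k. (?u a, ?v a) \<in> A)"
    proof -
      have "inj_on ?u {..<k}" "inj_on ?v {..<k}" using u(1) v(1) by (simp_all add: bij_betw_def)
      then have "single_valued R0" "single_valued (R0\<inverse>)"
        unfolding R0_def single_valued_def by (auto simp: inj_on_eq_iff)
      moreover have "Domain R0 = U" "Range R0 = V"
        using u(1) v(1) by (auto simp: R0_def bij_betw_def Domain_fst Range_snd image_image)
      ultimately show ?thesis by (auto simp: R0_def)
    qed
    moreover have "real (card M) = of_bool (R0 \<in> M)" if "\<And>R. R \<in> M \<Longrightarrow> R = R0" for M
    proof -
      have "M \<subseteq> {R0}" using that by blast
      then have "M = {} \<or> M = {R0}" by (rule subset_singletonD)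
      then show ?thesis by auto
    qed
    ultimately have "real (card ?M) = of_bool (\<forall>a<k. (?u a, ?v a) \<in> A)"
      using unique by (simp only:)
    also have "\<dots> = (\<Prod>a<k. of_bool ((?u a, ?v a) \<in> A))"
    proof (cases "\<forall>a<k. (?u a, ?v a) \<in> A")
      case False
      then have "(\<Prod>a<k. of_bool ((?u a, ?v a) \<in> A)) = (0 :: real)" by (intro prod_zero) auto
      then show ?thesis using False by simp
    qed simp
    finally show ?thesis using eq True by (simp add: k_def)
  qed
qed

subsection \<open>The spectrum of the strand matrices\<close>

text \<open>Each term times \<open>2 * sin (\<phi> / 2)\<close> is a difference of sines at
  consecutive half-integer multiples of \<open>\<phi>\<close>.\<close>

lemma cos_sum_telescope:
  "2 * sin (\<phi> / 2) * (\<Sum>k = 1..s. cos (real k * \<phi>)) = sin ((real s + 1 / 2) * \<phi>) - sin (\<phi> / 2)"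
proof (induction s)
  case (Suc s)
  have "2 * sin (\<phi> / 2) * cos (real (Suc s) * \<phi>)
      = sin (\<phi> / 2 + real (Suc s) * \<phi>) - sin (real (Suc s) * \<phi> - \<phi> / 2)"
    by (simp add: sin_add sin_diff)
  moreover have "\<phi> / 2 + real (Suc s) * \<phi> = (real (Suc s) + 1 / 2) * \<phi>"
    "real (Suc s) * \<phi> - \<phi> / 2 = (real s + 1 / 2) * \<phi>"
    by (simp_all add: algebra_simps)
  ultimately show ?case
    using Suc by (simp add: distrib_left)
qed simp

text \<open>For odd \<open>n\<close> the value depends on the parity of \<open>d\<close>, because the midpoint term
  \<open>cos (d * pi)\<close> is missing from the sum.\<close>

lemma cos_sum_value:
  fixes d :: int
  assumes d: "d \<noteq> 0" "\<bar>d\<bar> < int n + 1"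
  shows "(\<Sum>k = 1..n div 2. cos (real k * (2 * of_int d * pi / (real n + 1))))
    = (if even n then - 1 / 2 else - (1 + (if even d then 1 else - 1)) / 2)" (is "?C = _")
proof -
  define s where "s = n div 2"
  define \<psi> where "\<psi> = of_int d * pi / (real n + 1)"
  have \<phi>: "2 * of_int d * pi / (real n + 1) = 2 * \<psi>" by (simp add: \<psi>_def)
  have tel: "2 * sin \<psi> * ?C = sin ((2 * real s + 1) * \<psi>) - sin \<psi>"
    unfolding \<phi> using cos_sum_telescope[of "2 * \<psi>" s] by (simp add: s_def algebra_simps)
  \<comment> \<open>A zero would make \<open>d\<close> a multiple of \<open>n + 1\<close>, which its
    bounds exclude.\<close>
  have nz: "sin \<psi> \<noteq> 0"
  proof
    assume "sin \<psi> = 0"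
    then obtain i where "\<psi> = of_int i * pi" by (auto simp: sin_zero_iff_int2)
    then have "real_of_int d * pi = (of_int i * (real n + 1)) * pi"
      by (simp add: \<psi>_def divide_eq_eq mult_ac)
    then have "real_of_int d = of_int i * (real n + 1)" by (simp only: mult_cancel_right) simp
    then have "real_of_int d = real_of_int (i * (int n + 1))" by simp
    then have "d = i * (int n + 1)" by (subst (asm) of_int_eq_iff)
    moreover from this d(1) have "\<bar>i\<bar> \<ge> 1" by auto
    moreover from this have "1 * (int n + 1) \<le> \<bar>i\<bar> * (int n + 1)" by (intro mult_right_mono) auto
    moreover have "\<bar>d\<bar> = \<bar>i\<bar> * (int n + 1)"
      by (simp add: \<open>d = i * (int n + 1)\<close> abs_mult)
    ultimately show False using d(2) by (metis mult_1 not_le)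
  qed
  have sd: "sin (of_int d * pi) = 0" by (simp add: sin_zero_iff_int2)
  have cd: "cos (of_int d * pi) = (if even d then 1 else - 1)"
    by (auto elim!: evenE oddE simp: cos_add distrib_right mult.assoc)
      (metis cos_int_2pin mult.assoc mult.commute)+
  show ?thesis
  proof (cases "even n")
    case True
    \<comment> \<open>Here \<open>2 * s + 1\<close> equals \<open>n + 1\<close>, so the angle is a
      multiple of \<open>pi\<close> and its sine vanishes.\<close>
    then have "(2 * real s + 1) * \<psi> = of_int d * pi" by (auto simp: s_def \<psi>_def elim!: evenE)
    with tel sd have "sin \<psi> * (2 * ?C + 1) = 0" by (simp add: algebra_simps)
    with nz True show ?thesis by simp
  next
    case False
    \<comment> \<open>For odd \<open>n\<close> the angle falls short of \<open>d * pi\<close> by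
      \<open>\<psi>\<close>, and the parity of \<open>d\<close> enters through
      \<open>cos (d * pi)\<close>.\<close>
    then have "2 * real s + 1 = real n" by (auto simp: s_def elim!: oddE)
    then have "(2 * real s + 1) * \<psi> = of_int d * pi - \<psi>"
      by (simp add: \<psi>_def field_simps)
    then have "sin ((2 * real s + 1) * \<psi>) = - (if even d then 1 else - 1) * sin \<psi>"
      by (simp add: sin_diff sd cd)
    with tel have "sin \<psi> * (2 * ?C + (1 + (if even d then 1 else - 1))) = 0"
      by (simp add: algebra_simps)
    with nz False show ?thesis by (simp only: mult_eq_0_iff if_False) (simp add: algebra_simps)
  qed
qed

text \<open>Numbering an odd strand along its path from \<open>v_1\<close> gives \<open>u_j\<close>
  the position \<open>2 * j\<close>; the entry is the value there of the \<open>k\<close>-th sine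
  eigenvector of the path on \<open>n\<close> vertices.\<close>

definition sine_mat :: "nat \<Rightarrow> nat \<Rightarrow> nat \<Rightarrow> real" where
  "sine_mat n j k = sin (2 * real j * (real k * pi / (real n + 1)))"

lemma sine_mat_sym: "sine_mat n j k = sine_mat n k j"
  by (simp add: sine_mat_def mult_ac)

lemma sine_mat_alt: "sine_mat n k j = sin (2 * real j * (real k * pi / (real n + 1)))"
  by (subst sine_mat_sym) (rule sine_mat_def)

text \<open>Product-to-sum leaves the cosine sums for \<open>a - c\<close> and \<open>a + c\<close>,
  which have the same parity; by \<open>cos_sum_value\<close> they cancel unless
  \<open>a = c\<close>, when every term of the first is 1.\<close>

lemma sine_mat_orthogonal:
  assumes "a \<in> {1..n div 2}" "c \<in> {1..n div 2}"
  shows "(\<Sum>k = 1..n div 2. sine_mat n a k * sine_mat n k c) = (if a = c then (real n + 1) / 4 else 0)"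
proof -
  define C where "C d = (\<Sum>k = 1..n div 2. cos (real k * (2 * of_int d * pi / (real n + 1))))" for d
  have "(\<Sum>k = 1..n div 2. sine_mat n a k * sine_mat n k c)
      = (\<Sum>k = 1..n div 2. (cos (real k * (2 * of_int (int a - int c) * pi / (real n + 1)))
        - cos (real k * (2 * of_int (int a + int c) * pi / (real n + 1)))) / 2)"
    by (intro sum.cong refl, simp only: sine_mat_sym[of n _ c], simp only: sine_mat_def sin_times_sin)
      (simp add: algebra_simps diff_divide_distrib add_divide_distrib)
  also have "\<dots> = (C (int a - int c) - C (int a + int c)) / 2"
    by (simp add: C_def sum_subtractf flip: sum_divide_distrib)
  finally have eq: "(\<Sum>k = 1..n div 2. sine_mat n a k * sine_mat n k c)
      = (C (int a - int c) - C (int a + int c)) / 2" .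
  have plus: "C (int a + int c) = (if even n then - 1 / 2 else - (1 + (if even (int a + int c) then 1 else - 1)) / 2)"
    unfolding C_def by (rule cos_sum_value) (use assms in auto)
  show ?thesis
  proof (cases "a = c")
    case True
    then have "C (int a - int c) = real (n div 2)" by (simp add: C_def)
    then show ?thesis using plus True eq by (cases "even n") (auto elim!: evenE oddE)
  next
    case False
    then have "C (int a - int c) = (if even n then - 1 / 2 else - (1 + (if even (int a - int c) then 1 else - 1)) / 2)"
      unfolding C_def by (intro cos_sum_value) (use assms in auto)
    moreover have "even (int a - int c) \<longleftrightarrow> even (int a + int c)" by simp
    ultimately show ?thesis using plus False eq by (simp only: if_False) simp
  qed
qed

section \<open>Strand matrices acting on sine vectors\<close>

text \<open>Without index ranges one formula serves both parities of \<open>n\<close>; the ranges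
  enter through \<open>path_mat\<close> and \<open>strand_pairs\<close>.\<close>

definition strand_adj :: "nat \<Rightarrow> nat \<Rightarrow> nat \<Rightarrow> bool" where
  "strand_adj i a b \<longleftrightarrow> b = a \<or> (if odd i then b = a + 1 else a = b + 1)"

definition strand_mat :: "nat \<Rightarrow> nat \<Rightarrow> nat \<Rightarrow> real" where
  "strand_mat i a b = of_bool (strand_adj i a b)"

text \<open>In the uses, \<open>c\<close> and \<open>d\<close> are the neighbours of a vertex. One
  outside \<open>T\<close> is harmless where \<open>g\<close> vanishes, which takes care of the ends
  of the path.\<close>

lemma sum_pick_two:
  fixes g :: "nat \<Rightarrow> real"
  assumes "finite T" "c \<noteq> d" "c \<notin> T \<Longrightarrow> g c = 0" "d \<notin> T \<Longrightarrow> g d = 0"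
  shows "(\<Sum>a\<in>T. g a * of_bool (a = c \<or> a = d)) = g c + g d"
proof -
  have "(\<Sum>a\<in>T. g a * of_bool (a = c \<or> a = d)) = (\<Sum>a\<in>T. (if a = c then g a else 0) + (if a = d then g a else 0))"
    using assms(2) by (intro sum.cong) auto
  then show ?thesis using assms by (simp add: sum.distrib)
qed

text \<open>The top vertex \<open>v_b\<close> has position \<open>2 * b - 1\<close> on the path and
  neighbours at \<open>2 * b\<close> and \<open>2 * b - 2\<close>, so this is \<open>sin (y +
  \<theta>) + sin (y - \<theta>) = 2 * cos \<theta> * sin y\<close>.\<close>

lemma strand_mat_odd_sine:
  assumes i: "odd i" and b: "b \<in> {1..(n + 1) div 2}"
  shows "(\<Sum>a = 1..n div 2. sine_mat n k a * strand_mat i a b)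
    = 2 * cos (real k * pi / (real n + 1)) * sin ((2 * real b - 1) * (real k * pi / (real n + 1)))"
proof -
  define \<theta> where "\<theta> = real k * pi / (real n + 1)"
  have "(\<Sum>a = 1..n div 2. sine_mat n k a * strand_mat i a b)
      = (\<Sum>a = 1..n div 2. sine_mat n k a * of_bool (a = b \<or> a = b - 1))"
    using i b by (intro sum.cong refl) (auto simp: strand_mat_def strand_adj_def)
  also have "\<dots> = sine_mat n k b + sine_mat n k (b - 1)"
  proof (rule sum_pick_two)
    \<comment> \<open>The sine vector vanishes at the positions \<open>n + 1\<close> and 0 just
      outside the path.\<close>
    show "sine_mat n k b = 0" if "b \<notin> {1..n div 2}"
    proof -
      from that b have "2 * b = n + 1" by auto
      then have "2 * real b = real n + 1" by linarith
      then have "sine_mat n b k = sin (real k * pi)" by (simp add: sine_mat_def)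
      then show ?thesis by (simp add: sine_mat_sym)
    qed
    show "sine_mat n k (b - 1) = 0" if "b - 1 \<notin> {1..n div 2}"
    proof -
      from that b have "b - 1 = 0" by auto
      then show ?thesis by (simp add: sine_mat_def)
    qed
  qed (use b in auto)
  also have "\<dots> = sin ((2 * real b - 1) * \<theta> + \<theta>) + sin ((2 * real b - 1) * \<theta> - \<theta>)"
    using b unfolding sine_mat_alt \<theta>_def[symmetric]
    by (simp only: of_nat_diff atLeastAtMost_iff) (simp add: algebra_simps)
  also have "\<dots> = 2 * cos \<theta> * sin ((2 * real b - 1) * \<theta>)"
    by (simp add: sin_add sin_diff)
  finally show ?thesis by (simp add: \<theta>_def)
qed

text \<open>An even strand starts at \<open>u_1\<close>, so \<open>u_b\<close> has position
  \<open>2 * b - 1\<close> and \<open>v_c\<close> position \<open>2 * c\<close>; the same recurrence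
  leads from the odd positions back to the even ones.\<close>

lemma strand_mat_even_sine:
  assumes i: "even i" and c: "c \<in> {1..n div 2}"
  shows "(\<Sum>b = 1..(n + 1) div 2. sin ((2 * real b - 1) * (real k * pi / (real n + 1))) * strand_mat i b c)
    = 2 * cos (real k * pi / (real n + 1)) * sine_mat n k c"
proof -
  define \<theta> where "\<theta> = real k * pi / (real n + 1)"
  have "(\<Sum>b = 1..(n + 1) div 2. sin ((2 * real b - 1) * \<theta>) * strand_mat i b c)
      = (\<Sum>b = 1..(n + 1) div 2. sin ((2 * real b - 1) * \<theta>) * of_bool (b = c \<or> b = c + 1))"
    using i by (intro sum.cong refl) (auto simp: strand_mat_def strand_adj_def)
  also have "\<dots> = sin ((2 * real c - 1) * \<theta>) + sin ((2 * real (c + 1) - 1) * \<theta>)"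
  proof (rule sum_pick_two)
    show "sin ((2 * real (c + 1) - 1) * \<theta>) = 0" if "c + 1 \<notin> {1..(n + 1) div 2}"
    proof -
      from that c have "2 * c = n" by auto
      then have "2 * real c = real n" by linarith
      then have "(2 * real (c + 1) - 1) * \<theta> = real k * pi"
        by (simp add: \<theta>_def divide_eq_eq)
      then show ?thesis by simp
    qed
  qed (use c in auto)
  also have "\<dots> = sin (2 * real c * \<theta> - \<theta>) + sin (2 * real c * \<theta> + \<theta>)"
    by (simp add: algebra_simps)
  also have "\<dots> = 2 * cos \<theta> * sin (2 * real c * \<theta>)"
    by (simp add: sin_add sin_diff)
  finally show ?thesis by (simp only: \<theta>_def sine_mat_alt)
qed

text \<open>Among \<open>n\<close> positions, \<open>n div 2\<close> are even and
  \<open>(n + 1) div 2\<close> odd; bottom vertices occupy the even ones in odd strands and the odd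
  ones in even strands.\<close>

lemma bottom_count_eq: "bottom_count n i = (if odd i then n div 2 else (n + 1) div 2)"
  by (auto simp: bottom_count_def elim!: oddE evenE)

lemma top_count_eq: "top_count n i = (if odd i then (n + 1) div 2 else n div 2)"
  by (auto simp: top_count_def elim!: oddE evenE)

text \<open>An odd and an even strand together multiply the \<open>k\<close>-th sine vector by
  \<open>(2 * cos \<theta>)^2 = 2 + 2 * cos (2 * \<theta>)\<close>, where
  \<open>\<theta> = k * pi / (n + 1)\<close>. The case \<open>p = 0\<close> is orthogonality, which
  explains the factor \<open>4 / (n + 1)\<close>.\<close>

lemma path_mat_strand_spectral:
  assumes "a \<in> {1..n div 2}" "c \<in> {1..n div 2}"
  shows "path_mat (\<lambda>i. {1..bottom_count n i}) strand_mat (2 * p) a c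
    = (\<Sum>k = 1..n div 2. (4 / (real n + 1) * sine_mat n a k) *
        (2 + 2 * cos (2 * real k * pi / (real n + 1))) ^ p * sine_mat n k c)"
  using assms
proof (induction p arbitrary: a c)
  case 0
  have "(\<Sum>k = 1..n div 2. (4 / (real n + 1) * sine_mat n a k) * sine_mat n k c)
      = 4 / (real n + 1) * (\<Sum>k = 1..n div 2. sine_mat n a k * sine_mat n k c)"
    by (simp add: sum_distrib_left mult_ac)
  then show ?case using sine_mat_orthogonal[OF 0] by simp
next
  case (Suc p)
  let ?I = "\<lambda>i. {1..bottom_count n i}" and ?s = "n div 2" and ?t = "(n + 1) div 2"
  let ?\<mu> = "\<lambda>k::nat. 2 + 2 * cos (2 * real k * pi / (real n + 1))"
  let ?c = "\<lambda>k::nat. 2 * cos (real k * pi / (real n + 1))"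
  let ?q = "\<lambda>k b::nat. sin ((2 * real b - 1) * (real k * pi / (real n + 1)))"
  let ?C = "\<lambda>k. (4 / (real n + 1) * sine_mat n a k) * ?\<mu> k ^ p"
  have \<mu>: "?c k * ?c k = ?\<mu> k" for k
    using cos_double_cos[of "real k * pi / (real n + 1)"]
    by (simp add: power2_eq_square mult_ac)
  \<comment> \<open>Half of the double step: the sine vectors are now sampled at the odd
    positions.\<close>
  have odd: "path_mat ?I strand_mat (Suc (2 * p)) a b = (\<Sum>k = 1..?s. ?C k * (?c k * ?q k b))"
    if b: "b \<in> {1..?t}" for b
  proof -
    have "path_mat ?I strand_mat (Suc (2 * p)) a b
        = (\<Sum>e = 1..?s. (\<Sum>k = 1..?s. ?C k * sine_mat n k e) * strand_mat (Suc (2 * p)) e b)"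
      using Suc.IH[OF Suc.prems(1)] by (simp add: mat_comp_def bottom_count_eq)
    also have "\<dots> = (\<Sum>k = 1..?s. ?C k * (\<Sum>e = 1..?s. sine_mat n k e * strand_mat (Suc (2 * p)) e b))"
      by (simp only: sum_distrib_left sum_distrib_right mult.assoc) (rule sum.swap)
    also have "\<dots> = (\<Sum>k = 1..?s. ?C k * (?c k * ?q k b))"
      using b by (subst strand_mat_odd_sine) auto
    finally show ?thesis .
  qed
  have "path_mat ?I strand_mat (2 * Suc p) a c
      = (\<Sum>b = 1..?t. path_mat ?I strand_mat (Suc (2 * p)) a b * strand_mat (Suc (Suc (2 * p))) b c)"
    by (simp add: mat_comp_def[of _ "mat_comp _ _ _"] bottom_count_eq)
  also have "\<dots> = (\<Sum>b = 1..?t. (\<Sum>k = 1..?s. ?C k * (?c k * ?q k b)) * strand_mat (Suc (Suc (2 * p))) b c)"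
    by (intro sum.cong refl) (simp only: odd)
  also have "\<dots> = (\<Sum>k = 1..?s. ?C k * (?c k * (\<Sum>b = 1..?t. ?q k b * strand_mat (Suc (Suc (2 * p))) b c)))"
    by (simp only: sum_distrib_left sum_distrib_right mult.assoc) (rule sum.swap)
  also have "\<dots> = (\<Sum>k = 1..?s. ?C k * (?c k * (?c k * sine_mat n k c)))"
    using Suc.prems(2) by (subst strand_mat_even_sine) auto
  also have "\<dots> = (\<Sum>k = 1..?s. ?C k * (?\<mu> k * sine_mat n k c))"
    by (simp only: mult.assoc[symmetric] \<mu>[symmetric])
  finally show ?case by (simp add: mult_ac)
qed

text \<open>Up to the factor \<open>4 / (n + 1)\<close> the sine matrix is its own inverse, so it
  supplies both \<open>Q\<close> and \<open>R\<close> in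
  \<open>weighted_minor_trace_conjugation\<close>.\<close>

lemma weighted_strand_minor_trace:
  "(\<Sum>U\<in>Pow {1..n div 2}. X ^ (n div 2 - card U) *
      minor (path_mat (\<lambda>i. {1..bottom_count n i}) strand_mat (2 * p)) U U)
    = (\<Prod>k = 1..n div 2. X + (2 + 2 * cos (2 * real k * pi / (real n + 1))) ^ p)"
proof -
  let ?S = "{1..n div 2}"
  have "mat_comp ?S (sine_mat n) (\<lambda>a k. 4 / (real n + 1) * sine_mat n a k) k l
      = (if k = l then 1 else 0)" if "k \<in> ?S" "l \<in> ?S" for k l
  proof -
    have "mat_comp ?S (sine_mat n) (\<lambda>a k. 4 / (real n + 1) * sine_mat n a k) k l
        = 4 / (real n + 1) * (\<Sum>a = 1..n div 2. sine_mat n k a * sine_mat n a l)"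
      by (simp add: mat_comp_def sum_distrib_left mult_ac)
    then show ?thesis using sine_mat_orthogonal[OF that] by simp
  qed
  then show ?thesis
    using weighted_minor_trace_conjugation[of ?S "sine_mat n" "\<lambda>a k. 4 / (real n + 1) * sine_mat n a k"
        "path_mat (\<lambda>i. {1..bottom_count n i}) strand_mat (2 * p)"
        "\<lambda>k. (2 + 2 * cos (2 * real k * pi / (real n + 1))) ^ p" X, OF _ _ path_mat_strand_spectral]
    by simp
qed

subsection \<open>Perfect matchings as families of partial bijections\<close>

definition strand_pairs :: "nat \<Rightarrow> nat \<Rightarrow> (nat \<times> nat) set" where
  "strand_pairs n i = {(a, b). a \<in> {1..bottom_count n i} \<and> b \<in> {1..top_count n i} \<and> strand_adj i a b}"

definition strand_edge :: "nat \<Rightarrow> nat \<times> nat \<Rightarrow> hvertex set" where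
  "strand_edge i = (\<lambda>(a, b). {Bottom i a, Top i b})"

lemma strand_edge_eq_iff [simp]: "strand_edge i p = strand_edge i' p' \<longleftrightarrow> i = i' \<and> p = p'"
  by (cases p; cases p') (auto simp: strand_edge_def doubleton_eq_iff)

text \<open>This removes the case distinction on the parity of \<open>n\<close>: the ranges of the
  edge families are minima of (shifted) vertex counts.\<close>

lemma strand_edges_eq: "strand_edges n i = strand_edge i ` strand_pairs n i"
proof -
  have im: "{{Bottom i j, Top i j} | j. j \<in> J} = strand_edge i ` (\<lambda>j. (j, j)) ` J"
    "{{Bottom i j, Top i (j + 1)} | j. j \<in> J} = strand_edge i ` (\<lambda>j. (j, j + 1)) ` J"
    "{{Bottom i (j + 1), Top i j} | j. j \<in> J} = strand_edge i ` (\<lambda>j. (j + 1, j)) ` J" for J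
    unfolding strand_edge_def image_image prod.case by (rule Setcompr_eq_image)+
  have pairs: "strand_pairs n i = {(a, b). a \<in> {1..bottom_count n i} \<and> b \<in> {1..top_count n i} \<and> b = a}
      \<union> (if odd i then {(a, b). a \<in> {1..bottom_count n i} \<and> b \<in> {1..top_count n i} \<and> b = a + 1}
         else {(a, b). a \<in> {1..bottom_count n i} \<and> b \<in> {1..top_count n i} \<and> a = b + 1})"
    by (auto simp: strand_pairs_def strand_adj_def)
  have diag: "{(a, b). a \<in> {1..p} \<and> b \<in> {1..q} \<and> b = a} = (\<lambda>j. (j, j)) ` {1..min p q}" for p q :: nat
    by auto
  have up: "{(a, b). a \<in> {1..p} \<and> b \<in> {1..q} \<and> b = a + 1} = (\<lambda>j. (j, j + 1)) ` {1..min p (q - 1)}"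
    for p q :: nat
    by auto
  have down: "{(a, b). a \<in> {1..p} \<and> b \<in> {1..q} \<and> a = b + 1} = (\<lambda>j. (j + 1, j)) ` {1..min (p - 1) q}"
    for p q :: nat
    by auto
  show ?thesis
    unfolding strand_edges_def Let_def im pairs diag up down
    by (cases "odd i"; cases "even n") (simp_all add: image_Un bottom_count_def top_count_def min_def)
qed

text \<open>The matchings inside one strand, as relations; \<open>Domain\<close> and
  \<open>Range\<close> are the bottom and top indices they cover.\<close>

definition partial_bijections :: "nat \<Rightarrow> nat \<Rightarrow> (nat \<times> nat) set set" where
  "partial_bijections n i = {R. R \<subseteq> strand_pairs n i \<and> single_valued R \<and> single_valued (R\<inverse>)}"

text \<open>A perfect matching is encoded by its strand edges: \<open>R i\<close> pairs the bottom and top vertices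
  of \<open>S\<^sub>i\<close> that are matched inside the strand. All other vertices are matched by linking edges, so
  the top indices missed by \<open>R i\<close> are the bottom indices missed by the next relation.\<close>

definition strand_families :: "nat \<Rightarrow> nat \<Rightarrow> (nat \<Rightarrow> (nat \<times> nat) set) set" where
  "strand_families m n = {R \<in> PiE {1..m} (partial_bijections n).
     \<forall>i\<in>{1..m}. Range (R i) = Domain (R (next_strand m i))}"

definition matching_of :: "nat \<Rightarrow> nat \<Rightarrow> (nat \<Rightarrow> (nat \<times> nat) set) \<Rightarrow> hvertex set set" where
  "matching_of m n R = (\<Union>i\<in>{1..m}. strand_edge i ` R i)
     \<union> (\<Union>i\<in>{1..m}. link m i ` ({1..top_count n i} - Range (R i)))"

text \<open>The restriction to \<open>{1..m}\<close> places the family in the extensional space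
  \<open>PiE\<close>, so that decoding and encoding are mutually inverse.\<close>

definition family_of :: "nat \<Rightarrow> hvertex set set \<Rightarrow> nat \<Rightarrow> (nat \<times> nat) set" where
  "family_of m M = (\<lambda>i\<in>{1..m}. {p. strand_edge i p \<in> M})"

lemma next_strand_in: "i \<in> {1..m} \<Longrightarrow> next_strand m i \<in> {1..m}"
  by (auto simp: next_strand_def)

lemma next_strand_inj: "i \<in> {1..m} \<Longrightarrow> i' \<in> {1..m} \<Longrightarrow> next_strand m i = next_strand m i' \<longleftrightarrow> i = i'"
  by (auto simp: next_strand_def split: if_splits)

lemma next_strand_surj:
  assumes "i \<in> {1..m}" obtains i' where "i' \<in> {1..m}" "i = next_strand m i'"
  by (rule that[of "if i = 1 then m else i - 1"]) (use assms in \<open>auto simp: next_strand_def\<close>)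

lemma link_eq_iff [simp]: "link m i j = link m i' j' \<longleftrightarrow> i = i' \<and> j = j'"
  by (auto simp: link_def doubleton_eq_iff)

text \<open>An even \<open>m\<close> is not 1, so no strand is its own successor; with a single
  strand a link could coincide with a strand edge.\<close>

lemma strand_edge_neq_link:
  assumes "even m" "i' \<in> {1..m}"
  shows "strand_edge i p \<noteq> link m i' j" "link m i' j \<noteq> strand_edge i p"
proof -
  have "next_strand m i' \<noteq> i'" using assms by (auto simp: next_strand_def)
  then show "strand_edge i p \<noteq> link m i' j"
    by (cases p) (auto simp: strand_edge_def link_def doubleton_eq_iff)
  then show "link m i' j \<noteq> strand_edge i p" by metis
qed

text \<open>Since \<open>m\<close> is even, the parities of consecutive strands also differ between
  the last strand and the first.\<close>

lemma top_count_next: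
  "even m \<Longrightarrow> i \<in> {1..m} \<Longrightarrow> bottom_count n (next_strand m i) = top_count n i"
  by (auto simp: next_strand_def bottom_count_def top_count_def)

lemma Bottom_in_strand_edge [simp]: "Bottom i a \<in> strand_edge i' p \<longleftrightarrow> i = i' \<and> a = fst p"
  by (cases p) (auto simp: strand_edge_def)

lemma Top_in_strand_edge [simp]: "Top i b \<in> strand_edge i' p \<longleftrightarrow> i = i' \<and> b = snd p"
  by (cases p) (auto simp: strand_edge_def)

lemma Bottom_in_link [simp]: "Bottom i a \<in> link m i' j \<longleftrightarrow> i = next_strand m i' \<and> a = j"
  by (auto simp: link_def)

lemma Top_in_link [simp]: "Top i b \<in> link m i' j \<longleftrightarrow> i = i' \<and> b = j"
  by (auto simp: link_def)

lemma honeycomb_edges_eq: "honeycomb_edges m n = (\<Union>i\<in>{1..m}. strand_edge i ` strand_pairs n i)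
    \<union> (\<Union>i\<in>{1..m}. link m i ` {1..top_count n i})"
  by (auto simp: honeycomb_edges_def strand_edges_eq)

lemma honeycomb_vertices_iff [simp]:
  "Bottom i j \<in> honeycomb_vertices m n \<longleftrightarrow> i \<in> {1..m} \<and> j \<in> {1..bottom_count n i}"
  "Top i j \<in> honeycomb_vertices m n \<longleftrightarrow> i \<in> {1..m} \<and> j \<in> {1..top_count n i}"
  by (auto simp: honeycomb_vertices_def strand_vertices_def)

lemma strand_edge_in_matching_of:
  assumes "even m"
  shows "strand_edge i p \<in> matching_of m n R \<longleftrightarrow> i \<in> {1..m} \<and> p \<in> R i"
  unfolding matching_of_def Un_iff UN_iff image_iff strand_edge_eq_iff
  using strand_edge_neq_link(1)[OF assms] by blast

lemma link_in_matching_of: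
  assumes "even m" "i \<in> {1..m}"
  shows "link m i j \<in> matching_of m n R \<longleftrightarrow> j \<in> {1..top_count n i} - Range (R i)"
  unfolding matching_of_def Un_iff UN_iff image_iff link_eq_iff
  using strand_edge_neq_link(2)[OF assms] assms(2) by blast

lemma matching_of_cases:
  assumes "e \<in> matching_of m n R"
  obtains (strand) i p where "i \<in> {1..m}" "p \<in> R i" "e = strand_edge i p"
    | (link) i j where "i \<in> {1..m}" "j \<in> {1..top_count n i} - Range (R i)" "e = link m i j"
  using assms unfolding matching_of_def by blast

lemma honeycomb_edges_cases:
  assumes "e \<in> honeycomb_edges m n"
  obtains (strand) i p where "i \<in> {1..m}" "p \<in> strand_pairs n i" "e = strand_edge i p"
    | (link) i j where "i \<in> {1..m}" "j \<in> {1..top_count n i}" "e = link m i j"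
  using assms unfolding honeycomb_edges_eq by blast

lemma strand_edge_in_honeycomb_edges:
  assumes "even m"
  shows "strand_edge i p \<in> honeycomb_edges m n \<longleftrightarrow> i \<in> {1..m} \<and> p \<in> strand_pairs n i"
  unfolding honeycomb_edges_eq Un_iff UN_iff image_iff strand_edge_eq_iff
  using strand_edge_neq_link(1)[OF assms] by blast

text \<open>A vertex is covered by a strand edge if its index occurs in the relation of its strand,
  and by a link otherwise. The compatibility of \<open>Range\<close> and \<open>Domain\<close> makes
  the two ends of each link agree on this.\<close>

lemma perfect_matching_of:
  assumes m: "even m" and R: "R \<in> strand_families m n"
  shows "perfect_matching (honeycomb_vertices m n) (honeycomb_edges m n) (matching_of m n R)"
  unfolding perfect_matching_def
proof (intro conjI ballI)
  have RB: "R i \<subseteq> strand_pairs n i" "single_valued (R i)" "single_valued ((R i)\<inverse>)"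
    "Range (R i) = Domain (R (next_strand m i))" if "i \<in> {1..m}" for i
    using R that by (auto simp: strand_families_def partial_bijections_def PiE_iff)
  show "matching_of m n R \<subseteq> honeycomb_edges m n"
    unfolding matching_of_def honeycomb_edges_eq using RB(1) by (intro Un_mono UN_mono) auto
  fix v assume v: "v \<in> honeycomb_vertices m n"
  show "\<exists>!e. e \<in> matching_of m n R \<and> v \<in> e"
  proof (cases v)
    case (Top i b)
    with v have i: "i \<in> {1..m}" and b: "b \<in> {1..top_count n i}" by auto
    show ?thesis
    proof (cases "b \<in> Range (R i)")
      case True
      then obtain a where a: "(a, b) \<in> R i" by blast
      show ?thesis
      proof (rule ex1I)
        show "strand_edge i (a, b) \<in> matching_of m n R \<and> v \<in> strand_edge i (a, b)"
          using a i Top by (simp add: strand_edge_in_matching_of[OF m])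
        fix e assume e: "e \<in> matching_of m n R \<and> v \<in> e"
        from e have "e \<in> matching_of m n R" ..
        then show "e = strand_edge i (a, b)"
        proof (cases rule: matching_of_cases)
          case (strand i' p)
          then have "i' = i" "(fst p, b) \<in> R i" "snd p = b" using e Top by auto
          then have "fst p = a" using single_valuedD[OF RB(3)[OF i]] a by blast
          then show ?thesis using \<open>i' = i\<close> \<open>snd p = b\<close> strand(3) by auto
        qed (use e Top True in auto)
      qed
    next
      case False
      show ?thesis
      proof (rule ex1I)
        show "link m i b \<in> matching_of m n R \<and> v \<in> link m i b"
          using False b i Top by (simp add: link_in_matching_of[OF m])
        fix e assume e: "e \<in> matching_of m n R \<and> v \<in> e"
        from e have "e \<in> matching_of m n R" ..
        then show "e = link m i b"
        proof (cases rule: matching_of_cases)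
          case (strand i' p)
          then have "(fst p, b) \<in> R i" using e Top by auto
          then show ?thesis using False by blast
        qed (use e Top in auto)
      qed
    qed
  next
    case (Bottom i a)
    with v have i: "i \<in> {1..m}" and a: "a \<in> {1..bottom_count n i}" by auto
    \<comment> \<open>The link at a bottom vertex comes from the preceding strand
      \<open>h\<close>.\<close>
    from i obtain h where h: "h \<in> {1..m}" "i = next_strand m h" by (rule next_strand_surj)
    have dom: "Domain (R i) = Range (R h)" using RB(4) h by simp
    have at: "a \<in> {1..top_count n h}" using a h top_count_next[OF m] by simp
    show ?thesis
    proof (cases "a \<in> Domain (R i)")
      case True
      then obtain b where b: "(a, b) \<in> R i" by blast
      show ?thesis
      proof (rule ex1I)
        show "strand_edge i (a, b) \<in> matching_of m n R \<and> v \<in> strand_edge i (a, b)"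
          using b i Bottom by (simp add: strand_edge_in_matching_of[OF m])
        fix e assume e: "e \<in> matching_of m n R \<and> v \<in> e"
        from e have "e \<in> matching_of m n R" ..
        then show "e = strand_edge i (a, b)"
        proof (cases rule: matching_of_cases)
          case (strand i' p)
          then have "i' = i" "(a, snd p) \<in> R i" "fst p = a" using e Bottom by auto
          then have "snd p = b" using single_valuedD[OF RB(2)[OF i]] b by blast
          then show ?thesis using \<open>i' = i\<close> \<open>fst p = a\<close> strand(3) by auto
        next
          case (link i' j)
          then have "i' = h" "j = a" using e Bottom h next_strand_inj by auto
          then show ?thesis using link True dom by auto
        qed
      qed
    next
      case False
      show ?thesis
      proof (rule ex1I)
        show "link m h a \<in> matching_of m n R \<and> v \<in> link m h a"
          using False at h Bottom dom by (simp add: link_in_matching_of[OF m])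
        fix e assume e: "e \<in> matching_of m n R \<and> v \<in> e"
        from e have "e \<in> matching_of m n R" ..
        then show "e = link m h a"
        proof (cases rule: matching_of_cases)
          case (strand i' p)
          then have "(a, snd p) \<in> R i" using e Bottom by auto
          then show ?thesis using False by blast
        next
          case (link i' j)
          then show ?thesis using e Bottom h next_strand_inj by auto
        qed
      qed
    qed
  qed
qed

text \<open>A link is absent exactly when its top end is matched inside its strand, and exactly when
  its bottom end is; comparing the two gives the compatibility condition.\<close>

lemma family_of_perfect_matching:
  assumes m: "even m"
    and M: "perfect_matching (honeycomb_vertices m n) (honeycomb_edges m n) M"
  shows "family_of m M \<in> strand_families m n" "matching_of m n (family_of m M) = M"
proof -
  let ?R = "family_of m M"
  have ME: "M \<subseteq> honeycomb_edges m n" using M by (simp add: perfect_matching_def)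
  have uniq: "e = e'"
    if "e \<in> M" "e' \<in> M" "v \<in> e" "v \<in> e'" "v \<in> honeycomb_vertices m n" for e e' v
    using M that unfolding perfect_matching_def by blast
  have ex: "\<exists>e\<in>M. v \<in> e" if "v \<in> honeycomb_vertices m n" for v
    using M that unfolding perfect_matching_def by blast
  have in_R: "p \<in> ?R i \<longleftrightarrow> strand_edge i p \<in> M" if "i \<in> {1..m}" for i p
    using that by (simp add: family_of_def)
  have pairs: "(a, b) \<in> strand_pairs n i \<and> a \<in> {1..bottom_count n i} \<and> b \<in> {1..top_count n i}"
    if "i \<in> {1..m}" "(a, b) \<in> ?R i" for i a b
    using that ME strand_edge_in_honeycomb_edges[OF m] in_R by (auto simp: strand_pairs_def)
  have Range_iff: "b \<in> Range (?R i) \<longleftrightarrow> link m i b \<notin> M"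
    if i: "i \<in> {1..m}" and b: "b \<in> {1..top_count n i}" for i b
  proof
    assume "b \<in> Range (?R i)"
    then obtain a where "strand_edge i (a, b) \<in> M" using in_R[OF i] by blast
    then show "link m i b \<notin> M"
      using uniq[of "strand_edge i (a, b)" "link m i b" "Top i b"] i b strand_edge_neq_link[OF m i]
      by auto
  next
    assume l: "link m i b \<notin> M"
    obtain e where e: "e \<in> M" "Top i b \<in> e" using ex[of "Top i b"] i b by auto
    from e(1) ME have "e \<in> honeycomb_edges m n" by blast
    then show "b \<in> Range (?R i)"
    proof (cases rule: honeycomb_edges_cases)
      case (strand i' p)
      then have "(fst p, b) \<in> ?R i" using e i in_R by auto
      then show ?thesis by blast
    qed (use e l in auto)
  qed
  have Domain_iff: "b \<in> Domain (?R (next_strand m i)) \<longleftrightarrow> link m i b \<notin> M"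
    if i: "i \<in> {1..m}" and b: "b \<in> {1..top_count n i}" for i b
  proof
    let ?i = "next_strand m i"
    have i': "?i \<in> {1..m}" using i by (rule next_strand_in)
    have b': "b \<in> {1..bottom_count n ?i}" using top_count_next[OF m i] b by simp
    {
      assume "b \<in> Domain (?R ?i)"
      then obtain c where "strand_edge ?i (b, c) \<in> M" using in_R[OF i'] by blast
      then show "link m i b \<notin> M"
        using uniq[of "strand_edge ?i (b, c)" "link m i b" "Bottom ?i b"] i' b'
          strand_edge_neq_link[OF m i]
        by auto
    next
      assume l: "link m i b \<notin> M"
      obtain e where e: "e \<in> M" "Bottom ?i b \<in> e" using ex[of "Bottom ?i b"] i' b' by auto
      from e(1) ME have "e \<in> honeycomb_edges m n" by blast
      then show "b \<in> Domain (?R ?i)"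
      proof (cases rule: honeycomb_edges_cases)
        case (strand h p)
        then have "(b, snd p) \<in> ?R ?i" using e i' in_R by auto
        then show ?thesis by blast
      next
        case (link h j)
        then show ?thesis using e l next_strand_inj[OF i] by auto
      qed
    }
  qed
  have "?R i \<in> partial_bijections n i" if i: "i \<in> {1..m}" for i
  proof -
    have "single_valued (?R i)"
    proof (rule single_valuedI)
      fix a b c assume ab: "(a, b) \<in> ?R i" "(a, c) \<in> ?R i"
      then have "strand_edge i (a, b) = strand_edge i (a, c)"
        using in_R[OF i] pairs[OF i ab(1)] i by (intro uniq[of _ _ "Bottom i a"]) auto
      then show "b = c" by simp
    qed
    moreover have "single_valued ((?R i)\<inverse>)"
    proof (rule single_valuedI)
      fix a b c assume ab: "(a, b) \<in> (?R i)\<inverse>" "(a, c) \<in> (?R i)\<inverse>"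
      then have "strand_edge i (b, a) = strand_edge i (c, a)"
        using in_R[OF i] pairs[OF i, of b a] i by (intro uniq[of _ _ "Top i a"]) auto
      then show "b = c" by simp
    qed
    ultimately show ?thesis using pairs[OF i] by (auto simp: partial_bijections_def)
  qed
  moreover have "Range (?R i) = Domain (?R (next_strand m i))" if i: "i \<in> {1..m}" for i
  proof -
    have "Range (?R i) \<subseteq> {1..top_count n i}" using pairs[OF i] by blast
    moreover have "Domain (?R (next_strand m i)) \<subseteq> {1..top_count n i}"
      using pairs[OF next_strand_in[OF i]] top_count_next[OF m i] by auto
    ultimately show ?thesis using Range_iff[OF i] Domain_iff[OF i] by blast
  qed
  ultimately show "?R \<in> strand_families m n"
    by (simp add: strand_families_def PiE_iff family_of_def)
  show "matching_of m n ?R = M"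
  proof (intro equalityI subsetI)
    fix e assume "e \<in> matching_of m n ?R"
    then show "e \<in> M"
    proof (cases rule: matching_of_cases)
      case (strand i p)
      then show ?thesis using in_R by simp
    next
      case (link i j)
      then show ?thesis using Range_iff by blast
    qed
  next
    fix e assume e: "e \<in> M"
    with ME have "e \<in> honeycomb_edges m n" by blast
    then show "e \<in> matching_of m n ?R"
    proof (cases rule: honeycomb_edges_cases)
      case (strand i p)
      then show ?thesis using e in_R by (simp add: strand_edge_in_matching_of[OF m])
    next
      case (link i j)
      then show ?thesis using e Range_iff by (auto simp: link_in_matching_of[OF m])
    qed
  qed
qed

section \<open>The matching sum as a sum of products of minors\<close>

lemma finite_strand_pairs: "finite (strand_pairs n i)"
  by (rule finite_subset[of _ "{1..bottom_count n i} \<times> {1..top_count n i}"])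
    (auto simp: strand_pairs_def)

text \<open>Strand edges have weight 1, and strand \<open>i\<close> contributes one factor
  \<open>x i\<close> for each top index missed by \<open>R i\<close>.\<close>

lemma weight_matching_of:
  assumes m: "even m" and R: "R \<in> strand_families m n"
  shows "(\<Prod>e\<in>matching_of m n R. honeycomb_weight m n x e)
    = (\<Prod>i = 1..m. x i ^ (top_count n i - card (Range (R i))))"
proof -
  let ?w = "honeycomb_weight m n x"
  have RB: "R i \<subseteq> strand_pairs n i" if "i \<in> {1..m}" for i
    using R that by (auto simp: strand_families_def partial_bijections_def PiE_iff)
  have fR: "finite (R i)" if "i \<in> {1..m}" for i
    using RB[OF that] finite_strand_pairs by (rule finite_subset)
  let ?A = "\<Union>i\<in>{1..m}. strand_edge i ` R i"
  let ?B = "\<lambda>i. link m i ` ({1..top_count n i} - Range (R i))"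
  have "?A \<inter> (\<Union>i\<in>{1..m}. ?B i) = {}" using strand_edge_neq_link[OF m] by blast
  then have "(\<Prod>e\<in>matching_of m n R. ?w e) = (\<Prod>e\<in>?A. ?w e) * (\<Prod>e\<in>(\<Union>i\<in>{1..m}. ?B i). ?w e)"
    unfolding matching_of_def using fR by (intro prod.union_disjoint) auto
  also have "(\<Prod>e\<in>?A. ?w e) = 1"
  proof (rule prod.neutral, safe)
    fix i p assume "i \<in> {1..m}" "p \<in> R i"
    then show "?w (strand_edge i p) = 1"
      using RB by (intro weight_strand_edge[of i]) (auto simp: strand_edges_eq)
  qed
  also have "(\<Prod>e\<in>(\<Union>i\<in>{1..m}. ?B i). ?w e) = (\<Prod>i = 1..m. \<Prod>e\<in>?B i. ?w e)"
    by (rule prod.UNION_disjoint) auto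
  also have "\<dots> = (\<Prod>i = 1..m. x i ^ (top_count n i - card (Range (R i))))"
  proof (rule prod.cong[OF refl])
    fix i assume i: "i \<in> {1..m}"
    have "Range (R i) \<subseteq> {1..top_count n i}" using RB[OF i] by (auto simp: strand_pairs_def)
    then have "card ({1..top_count n i} - Range (R i)) = top_count n i - card (Range (R i))"
      using finite_subset by (subst card_Diff_subset) auto
    moreover have "(\<Prod>e\<in>?B i. ?w e) = (\<Prod>j\<in>{1..top_count n i} - Range (R i). x i)"
      using weight_link[OF m i] by (subst prod.reindex) (auto intro: inj_onI)
    ultimately show "(\<Prod>e\<in>?B i. ?w e) = x i ^ (top_count n i - card (Range (R i)))" by simp
  qed
  finally show ?thesis by simp
qed

lemma honeycomb_matching_sum_families:
  assumes m: "even m"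
  shows "honeycomb_matching_sum m n x
    = (\<Sum>R\<in>strand_families m n. \<Prod>i = 1..m. x i ^ (top_count n i - card (Range (R i))))"
  unfolding honeycomb_matching_sum_def matching_sum_def
proof (rule sum.reindex_bij_witness[of _ "matching_of m n" "family_of m"])
  fix M assume "M \<in> {M. perfect_matching (honeycomb_vertices m n) (honeycomb_edges m n) M}"
  then have M: "perfect_matching (honeycomb_vertices m n) (honeycomb_edges m n) M" by simp
  note fam = family_of_perfect_matching[OF m M]
  show "matching_of m n (family_of m M) = M" "family_of m M \<in> strand_families m n" by (fact fam)+
  show "(\<Prod>i = 1..m. x i ^ (top_count n i - card (Range (family_of m M i))))
      = prod (honeycomb_weight m n x) M"
    using weight_matching_of[OF m fam(1), of x] unfolding fam(2) by simp
next
  fix R assume R: "R \<in> strand_families m n"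
  then show "matching_of m n R \<in> {M. perfect_matching (honeycomb_vertices m n) (honeycomb_edges m n) M}"
    using perfect_matching_of[OF m] by simp
  have "R \<in> extensional {1..m}" using R by (simp add: strand_families_def PiE_iff)
  then show "family_of m (matching_of m n R) = R"
    by (intro extensionalityI[of _ "{1..m}"])
      (auto simp: family_of_def strand_edge_in_matching_of[OF m])
qed

text \<open>Adjacency in a strand is a staircase: a bottom index \<open>u\<close> meets only
  \<open>u\<close> and \<open>u + 1\<close>, or only \<open>u - 1\<close> and \<open>u\<close>. It
  is therefore monotone, and \<open>card_monotone_matchings\<close> applies.\<close>

lemma card_strand_matchings:
  assumes "U \<subseteq> {1..bottom_count n i}" "V \<subseteq> {1..top_count n i}"
  shows "real (card {R \<in> partial_bijections n i. Domain R = U \<and> Range R = V}) = minor (strand_mat i) U V"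
proof -
  have fin: "finite U" "finite V" using assms finite_subset by auto
  have "real (card {R \<in> partial_bijections n i. Domain R = U \<and> Range R = V})
      = minor (\<lambda>a b. of_bool ((a, b) \<in> strand_pairs n i)) U V"
  proof -
    have "v \<le> v'" if "(u, v) \<in> strand_pairs n i" "(u', v') \<in> strand_pairs n i" "u < u'" for u v u' v'
      using that by (cases "odd i") (auto simp: strand_pairs_def strand_adj_def)
    from card_monotone_matchings[OF fin this] show ?thesis
      by (simp only: partial_bijections_def mem_Collect_eq conj_assoc)
  qed
  also have "\<dots> = minor (strand_mat i) U V"
    using assms fin by (intro minor_cong) (auto simp: strand_mat_def strand_pairs_def)
  finally show ?thesis .
qed

text \<open>Families are grouped by their domains \<open>U\<close>, which also fix the ranges; for
  fixed \<open>U\<close> the strands are independent and the sum factors.\<close>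

lemma honeycomb_matching_sum_minors:
  assumes m: "even m"
  shows "honeycomb_matching_sum m n x
    = (\<Sum>U\<in>PiE {1..m} (\<lambda>i. Pow {1..bottom_count n i}).
        \<Prod>i = 1..m. x i ^ (top_count n i - card (U (next_strand m i))) *
          minor (strand_mat i) (U i) (U (next_strand m i)))"
proof -
  let ?N = "next_strand m"
  let ?T = "PiE {1..m} (\<lambda>i. Pow {1..bottom_count n i})"
  let ?W = "\<lambda>R. \<Prod>i = 1..m. x i ^ (top_count n i - card (Range (R i)))"
  let ?B = "\<lambda>U i. {R \<in> partial_bijections n i. Domain R = U i \<and> Range R = U (?N i)}"
  have fB: "finite (partial_bijections n i)" for i
    by (rule finite_subset[of _ "Pow (strand_pairs n i)"])
      (auto simp: partial_bijections_def finite_strand_pairs)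
  have fF: "finite (strand_families m n)"
    by (rule finite_subset[of _ "PiE {1..m} (partial_bijections n)"])
      (auto simp: strand_families_def fB intro!: finite_PiE)
  have "(\<Sum>R\<in>strand_families m n. ?W R)
      = (\<Sum>U\<in>?T. \<Sum>R | R \<in> strand_families m n \<and> (\<lambda>i\<in>{1..m}. Domain (R i)) = U. ?W R)"
  proof (rule sum.group[OF fF, symmetric])
    show "finite ?T" by (intro finite_PiE) auto
    show "(\<lambda>R. \<lambda>i\<in>{1..m}. Domain (R i)) ` strand_families m n \<subseteq> ?T"
      by (fastforce simp: strand_families_def partial_bijections_def strand_pairs_def PiE_iff)
  qed
  also have "\<dots> = (\<Sum>U\<in>?T. \<Prod>i = 1..m. x i ^ (top_count n i - card (U (?N i))) *
      minor (strand_mat i) (U i) (U (?N i)))"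
  proof (rule sum.cong[OF refl])
    fix U assume U: "U \<in> ?T"
    have fam: "{R. R \<in> strand_families m n \<and> (\<lambda>i\<in>{1..m}. Domain (R i)) = U} = PiE {1..m} (?B U)"
    proof (intro equalityI subsetI)
      fix R assume "R \<in> {R. R \<in> strand_families m n \<and> (\<lambda>i\<in>{1..m}. Domain (R i)) = U}"
      then have R: "R \<in> strand_families m n" and RU: "(\<lambda>i\<in>{1..m}. Domain (R i)) = U" by auto
      have "Domain (R i) = U i" if "i \<in> {1..m}" for i using RU that by auto
      then show "R \<in> PiE {1..m} (?B U)"
        using R next_strand_in[of _ m] by (auto simp: strand_families_def PiE_iff)
    next
      fix R assume R: "R \<in> PiE {1..m} (?B U)"
      then have dom: "Domain (R i) = U i" "Range (R i) = U (?N i)" "R i \<in> partial_bijections n i"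
        if "i \<in> {1..m}" for i using that by (auto simp: PiE_iff)
      have "(\<lambda>i\<in>{1..m}. Domain (R i)) = U"
        using U dom(1) by (auto simp: PiE_iff extensional_def fun_eq_iff)
      moreover have "R \<in> strand_families m n"
        using R dom next_strand_in[of _ m] unfolding strand_families_def by (simp add: PiE_iff)
      ultimately show "R \<in> {R. R \<in> strand_families m n \<and> (\<lambda>i\<in>{1..m}. Domain (R i)) = U}" by simp
    qed
    have "(\<Sum>R\<in>PiE {1..m} (?B U). ?W R)
        = (\<Sum>R\<in>PiE {1..m} (?B U). \<Prod>i = 1..m. x i ^ (top_count n i - card (U (?N i))))"
      by (intro sum.cong prod.cong refl) (auto simp: PiE_iff)
    also have "\<dots> = (\<Prod>i = 1..m. \<Sum>R\<in>?B U i. x i ^ (top_count n i - card (U (?N i))))"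
      using fB by (intro prod_sum_PiE[symmetric]) auto
    also have "\<dots> = (\<Prod>i = 1..m. x i ^ (top_count n i - card (U (?N i))) *
        minor (strand_mat i) (U i) (U (?N i)))"
    proof (rule prod.cong[OF refl])
      fix i assume i: "i \<in> {1..m}"
      have "U i \<subseteq> {1..bottom_count n i}" "U (?N i) \<subseteq> {1..top_count n i}"
        using PiE_mem[OF U i] PiE_mem[OF U next_strand_in[OF i]] by (simp_all add: top_count_next[OF m i])
      then show "(\<Sum>R\<in>?B U i. x i ^ (top_count n i - card (U (?N i))))
          = x i ^ (top_count n i - card (U (?N i))) * minor (strand_mat i) (U i) (U (?N i))"
        by (simp add: card_strand_matchings[symmetric])
    qed
    finally show "(\<Sum>R | R \<in> strand_families m n \<and> (\<lambda>i\<in>{1..m}. Domain (R i)) = U. ?W R)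
        = (\<Prod>i = 1..m. x i ^ (top_count n i - card (U (?N i))) * minor (strand_mat i) (U i) (U (?N i)))"
      unfolding fam .
  qed
  finally show ?thesis unfolding honeycomb_matching_sum_families[OF m] .
qed

section \<open>Evaluation of the matching sum\<close>

text \<open>For odd \<open>n\<close> the odd strands have one top vertex more than
  \<open>n div 2\<close>, whence the extra factors; \<open>k \<le> n div 2\<close> keeps the
  truncated subtractions exact.\<close>

lemma prod_powers_top_count:
  fixes x :: "nat \<Rightarrow> real"
  assumes "k \<le> n div 2"
  shows "(\<Prod>i = 1..m. x i ^ (top_count n i - k))
    = (if even n then 1 else \<Prod>i \<in> {i \<in> {1..m}. odd i}. x i) * (\<Prod>i = 1..m. x i) ^ (n div 2 - k)"
proof -
  have "(\<Prod>i = 1..m. x i ^ (top_count n i - k))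
      = (\<Prod>i = 1..m. (if odd n \<and> odd i then x i else 1) * x i ^ (n div 2 - k))"
  proof (rule prod.cong[OF refl])
    fix i
    have "top_count n i - k = of_bool (odd n \<and> odd i) + (n div 2 - k)"
      using assms by (auto simp: top_count_eq elim!: oddE)
    then show "x i ^ (top_count n i - k) = (if odd n \<and> odd i then x i else 1) * x i ^ (n div 2 - k)"
      by simp
  qed
  also have "\<dots> = (\<Prod>i = 1..m. if odd n \<and> odd i then x i else 1) * (\<Prod>i = 1..m. x i) ^ (n div 2 - k)"
    by (simp add: prod.distrib prod_power_distrib)
  also have "(\<Prod>i = 1..m. if odd n \<and> odd i then x i else 1)
      = (if even n then 1 else \<Prod>i \<in> {i \<in> {1..m}. odd i}. x i)"
    using prod.inter_filter[of "{1..m}" x odd] by simp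
  finally show ?thesis .
qed

theorem theorem3p1:
  fixes m n :: nat and x :: "nat \<Rightarrow> real"
  assumes "m > 0" and "even m" and "n > 0"
  shows "honeycomb_matching_sum m n x =
    (if even n then
       (\<Prod>k = 1..n div 2.
          ((\<Prod>i = 1..m. x i) + (2 + 2 * cos (2 * real k * pi / (real n + 1))) ^ (m div 2)))
     else
       (\<Prod>i \<in> {i \<in> {1..m}. odd i}. x i) *
       (\<Prod>k = 1..n div 2.
          ((\<Prod>i = 1..m. x i) + (2 + 2 * cos (2 * real k * pi / (real n + 1))) ^ (m div 2))))"
proof -
  let ?s = "n div 2" and ?X = "\<Prod>i = 1..m. x i"
  define c where "c = (if even n then 1 else \<Prod>i \<in> {i \<in> {1..m}. odd i}. x i)"
  let ?I = "\<lambda>i. {1..bottom_count n i}"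
  let ?w = "\<lambda>U. c * ?X ^ (?s - card U)"
  have summand: "(\<Prod>i = 1..m. x i ^ (top_count n i - card (U (next_strand m i))) *
        minor (strand_mat i) (U i) (U (next_strand m i)))
      = ?w (U 1) * (\<Prod>i = 1..m. minor (strand_mat i) (U i) (U (next_strand m i)))"
    if U: "U \<in> PiE {1..m} (\<lambda>i. Pow (?I i))" for U
  proof (cases "\<forall>i\<in>{1..m}. card (U i) = card (U (next_strand m i))")
    case False
    then obtain i where i: "i \<in> {1..m}" "card (U i) \<noteq> card (U (next_strand m i))" by blast
    \<comment> \<open>Unequal sizes in one strand make its minor zero, so both sides vanish.\<close>
    have "(\<Prod>i = 1..m. minor (strand_mat i) (U i) (U (next_strand m i))) = 0"
      by (rule prod_zero) (use i in \<open>auto simp: minor_def\<close>)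
    then show ?thesis by (simp only: prod.distrib mult_zero_right)
  next
    case True
    \<comment> \<open>Otherwise all sets have the size of \<open>U 1\<close>, the common exponent
      shift \<open>k\<close> in \<open>prod_powers_top_count\<close>.\<close>
    have card_Suc: "card (U (Suc i)) = card (U 1)" if "Suc i \<le> m" for i
      using that
    proof (induction i)
      case (Suc i)
      then have "card (U (Suc i)) = card (U (next_strand m (Suc i)))"
        by (intro bspec[OF True]) simp
      with Suc show ?case by (simp add: next_strand_def)
    qed simp
    have card_eq: "card (U (next_strand m i)) = card (U 1)" if "i \<in> {1..m}" for i
      using that card_Suc[of i] by (cases "i = m") (simp_all add: next_strand_def)
    have "U 1 \<subseteq> {1..?s}" using PiE_mem[OF U, of 1] \<open>m > 0\<close> by (simp add: bottom_count_eq)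
    then have "card (U 1) \<le> ?s" using card_mono[of "{1..?s}" "U 1"] by simp
    then have "(\<Prod>i = 1..m. x i ^ (top_count n i - card (U (next_strand m i)))) = ?w (U 1)"
      unfolding c_def by (subst prod_powers_top_count[symmetric]) (simp_all add: card_eq)
    then show ?thesis by (simp only: prod.distrib)
  qed
  have "honeycomb_matching_sum m n x = (\<Sum>U\<in>PiE {1..m} (\<lambda>i. Pow (?I i)).
      ?w (U 1) * (\<Prod>i = 1..m. minor (strand_mat i) (U i) (U (next_strand m i))))"
    unfolding honeycomb_matching_sum_minors[OF \<open>even m\<close>] by (rule sum.cong[OF refl summand])
  also have "\<dots> = (\<Sum>U\<in>Pow (?I 1). ?w U * minor (path_mat ?I strand_mat m) U U)"
    by (rule sum_minor_cycles) (use \<open>m > 0\<close> in auto)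
  \<comment> \<open>The first strand is odd, so its bottom indices form \<open>{1..n div 2}\<close>;
    \<open>m\<close> is written as \<open>2 * (m div 2)\<close> to match the double steps.\<close>
  also have "\<dots> = c * (\<Sum>U\<in>Pow {1..?s}. ?X ^ (?s - card U) * minor (path_mat ?I strand_mat (2 * (m div 2))) U U)"
    using \<open>even m\<close> by (simp add: bottom_count_eq[of n "Suc 0"] sum_distrib_left mult.assoc)
  also have "\<dots> = c * (\<Prod>k = 1..?s. ?X + (2 + 2 * cos (2 * real k * pi / (real n + 1))) ^ (m div 2))"
    by (simp only: weighted_strand_minor_trace)
  finally show ?thesis by (simp add: c_def)
qed

end
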